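(* For all $\beta>0$, $$(\bar R_\beta f)(0)=\sup_{x\in\mathbb{R}^d}(\bar R_\beta f)(x)=\Upsilon(\beta).$$ Thus, $(\bar R_\alpha f)(0)<\infty$ for all $\alpha>0$ if and only if $\Upsilon(1)<\infty$. Furthermore, if $(\bar R_\alpha f)(0)<\infty$ for all $\alpha>0$ (and/or $\Upsilon(1)<\infty$) and $f$ is lower semicontinuous, then for all $\beta>0$ there exists $\pi_\beta\in C_0(\mathbb{R}^d)$ such that $\bar R_\beta f=\pi_\beta$ almost everywhere.
   Context: $X=\{X_t\}_{t\ge0}$ is a Lévy process on $\mathbb{R}^d$ ($X_0=0$) with characteristic exponent $\Psi$: $E e^{i\xi\cdot X_t}=e^{-t\Psi(\xi)}$. It is assumed throughout that for every $t>0$ the law of $X_t$ has a density $p_t$ with respect to Lebesgue measure. Let $X^*$ be an independent copy of $-X$ and $\bar X_t:=X_t+X^*_t$ (the replica process), with semigroup $(\bar P_t\phi)(x)=E\phi(x+\bar X_t)$; for nonnegative measurable $\phi$ set $(\bar R_\alpha\phi)(x):=\int_0^\infty e^{-\alpha s}(\bar P_s\phi)(x)\,ds\in[0,\infty]$. $f:\mathbb{R}^d\to[0,\infty]$ is a nonnegative, nonnegative-definite, symmetric, locally integrable, tempered function, not identically zero, whose Fourier transform $\hat f$ (normalized by $\hat g(\xi)=\int e^{ix\cdot\xi}g(x)\,dx$) is a (nonnegative, measurable) function. Nonnegative-definite means $\int\int\phi(x)\phi(y)f(x-y)\,dx\,dy\ge0$ for all Schwartz functions $\phi$. $$\Upsilon(\beta):=\frac{1}{(2\pi)^d}\int_{\mathbb{R}^d}\frac{\hat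 f(\xi)}{\beta+2\,\mathrm{Re}\,\Psi(\xi)}\,d\xi\in[0,\infty].$$ $C_0(\mathbb{R}^d)$ is the space of continuous real functions on $\mathbb{R}^d$ vanishing at infinity. The equalities are in $[0,\infty]$. *)

theory Defs
  imports "HOL-Probability.Probability"
begin

section \<open>Schwartz functions and tempered functions\<close>

text \<open>The iterated partial derivative of \<open>g\<close> along the list \<open>bs\<close> of coordinate directions.\<close>

definition iter_partial ::
  "'a list \<Rightarrow> ('a::euclidean_space \<Rightarrow> 'b::real_normed_vector) \<Rightarrow> 'a \<Rightarrow> 'b"
  where "iter_partial bs g = foldr (\<lambda>b h x. frechet_derivative h (at x) b) bs g"

text \<open>Since the empty list is allowed and every iterated partial derivative is required to be
  differentiable, such a function is smooth.\<close>

definition schwartz :: "('a::euclidean_space \<Rightarrow> 'b::real_normed_vector) \<Rightarrow> bool"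
  where "schwartz g \<longleftrightarrow>
    (\<forall>bs\<in>lists Basis. iter_partial bs g differentiable_on UNIV \<and>
      (\<forall>k::nat. bounded (range (\<lambda>x. (1 + norm x) ^ k *\<^sub>R iter_partial bs g x))))"

definition schwartz_seminorm ::
  "nat \<Rightarrow> nat \<Rightarrow> ('a::euclidean_space \<Rightarrow> 'b::real_normed_vector) \<Rightarrow> real"
  where "schwartz_seminorm k m g =
    Sup {(1 + norm x) ^ k * norm (iter_partial bs g x) | x bs. bs \<in> lists Basis \<and> length bs \<le> m}"

text \<open>Functions that may take the value \<open>\<infinity>\<close> (such as Riesz kernels at the origin) are modelled as
  \<^typ>\<open>ennreal\<close>-valued.  A tempered function is one which, by integration, defines a continuous linear
  functional on the Schwartz space.  The finiteness condition forces \<open>f < \<infinity>\<close> almost everywhere, so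
  no mass is lost by \<^const>\<open>enn2real\<close>.\<close>

definition distr_pairing :: "('a::euclidean_space \<Rightarrow> ennreal) \<Rightarrow> ('a \<Rightarrow> complex) \<Rightarrow> complex"
  where "distr_pairing f \<phi> = (LINT x|lborel. of_real (enn2real (f x)) * \<phi> x)"

definition tempered :: "('a::euclidean_space \<Rightarrow> ennreal) \<Rightarrow> bool"
  where "tempered f \<longleftrightarrow>
    f \<in> borel_measurable borel \<and>
    (\<forall>\<phi>::'a \<Rightarrow> complex. schwartz \<phi> \<longrightarrow> (\<integral>\<^sup>+x. f x * ennreal (norm (\<phi> x)) \<partial>lborel) < \<infinity>) \<and>
    (\<exists>C k m. \<forall>\<phi>::'a \<Rightarrow> complex. schwartz \<phi> \<longrightarrow>
      norm (distr_pairing f \<phi>) \<le> C * schwartz_seminorm k m \<phi>)"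

definition fourier :: "('a::euclidean_space \<Rightarrow> complex) \<Rightarrow> 'a \<Rightarrow> complex"
  where "fourier g \<xi> = (LINT x|lborel. iexp (x \<bullet> \<xi>) * g x)"

text \<open>The Fourier transform of the tempered distribution \<open>f\<close> is (represented by) the function \<open>fhat\<close>.\<close>

definition has_fourier_transform ::
  "('a::euclidean_space \<Rightarrow> ennreal) \<Rightarrow> ('a \<Rightarrow> ennreal) \<Rightarrow> bool"
  where "has_fourier_transform f fhat \<longleftrightarrow> tempered f \<and> tempered fhat \<and>
    (\<forall>\<phi>. schwartz \<phi> \<longrightarrow> distr_pairing fhat \<phi> = distr_pairing f (fourier \<phi>))"

definition locally_integrable :: "('a::euclidean_space \<Rightarrow> ennreal) \<Rightarrow> bool"
  where "locally_integrable f \<longleftrightarrow> f \<in> borel_measurable borel \<and>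
    (\<forall>K. compact K \<longrightarrow> (\<integral>\<^sup>+x\<in>K. f x \<partial>lborel) < \<infinity>)"

text \<open>The test functions are real-valued.  For tempered \<open>f\<close> the double integral converges
  absolutely.\<close>

definition nonneg_definite :: "('a::euclidean_space \<Rightarrow> ennreal) \<Rightarrow> bool"
  where "nonneg_definite f \<longleftrightarrow>
    (\<forall>\<phi>::'a \<Rightarrow> real. schwartz \<phi> \<longrightarrow>
      0 \<le> (LINT x|lborel. (LINT y|lborel. \<phi> x * \<phi> y * enn2real (f (x - y)))))"

definition lower_semicontinuous :: "('a::topological_space \<Rightarrow> ennreal) \<Rightarrow> bool"
  where "lower_semicontinuous f \<longleftrightarrow> (\<forall>a. open {x. a < f x})"

definition C0 :: "('a::euclidean_space \<Rightarrow> real) set"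
  where "C0 = {g. continuous_on UNIV g \<and> (g \<longlongrightarrow> 0) at_infinity}"

section \<open>Levy processes\<close>

text \<open>Processes are indexed by \<^typ>\<open>real\<close>; only times \<open>t \<ge> 0\<close> are constrained.  Stochastic
  continuity is the regularity in the definition; it is implied by cadlag paths.\<close>

definition levy_process :: "'w measure \<Rightarrow> (real \<Rightarrow> 'w \<Rightarrow> 'a::euclidean_space) \<Rightarrow> bool"
  where "levy_process M X \<longleftrightarrow>
    prob_space M \<and>
    (\<forall>t\<ge>0. X t \<in> borel_measurable M) \<and>
    (AE \<omega> in M. X 0 \<omega> = 0) \<and>
    (\<forall>(n::nat) t. 0 \<le> t 0 \<and> (\<forall>i<n. t i < t (Suc i)) \<longrightarrow>
      prob_space.indep_vars M (\<lambda>_. borel) (\<lambda>i \<omega>. X (t (Suc i)) \<omega> - X (t i) \<omega>) {..<n}) \<and>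
    (\<forall>s\<ge>0. \<forall>t\<ge>0. distr M borel (\<lambda>\<omega>. X (s + t) \<omega> - X s \<omega>) = distr M borel (X t)) \<and>
    (\<forall>s\<ge>0. \<forall>\<epsilon>>0.
      ((\<lambda>t. measure M {\<omega> \<in> space M. \<epsilon> < dist (X t \<omega>) (X s \<omega>)}) \<longlongrightarrow> 0) (at s within {0..}))"

definition char_exponent ::
  "'w measure \<Rightarrow> (real \<Rightarrow> 'w \<Rightarrow> 'a::euclidean_space) \<Rightarrow> ('a \<Rightarrow> complex) \<Rightarrow> bool"
  where "char_exponent M X \<Psi> \<longleftrightarrow>
    (\<forall>t\<ge>0. \<forall>\<xi>. (LINT \<omega>|M. iexp (\<xi> \<bullet> X t \<omega>)) = exp (- of_real t * \<Psi> \<xi>))"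

text \<open>A process as a single random element of path space, with the product sigma-algebra.\<close>

abbreviation path_space :: "(real \<Rightarrow> 'a::euclidean_space) measure"
  where "path_space \<equiv> Pi\<^sub>M {0..} (\<lambda>_. borel)"

definition path_of :: "(real \<Rightarrow> 'w \<Rightarrow> 'a::euclidean_space) \<Rightarrow> 'w \<Rightarrow> real \<Rightarrow> 'a"
  where "path_of X \<omega> = (\<lambda>t\<in>{0..}. X t \<omega>)"

definition independent_copy_of_neg ::
  "'w measure \<Rightarrow> (real \<Rightarrow> 'w \<Rightarrow> 'a::euclidean_space) \<Rightarrow> (real \<Rightarrow> 'w \<Rightarrow> 'a) \<Rightarrow> bool"
  where "independent_copy_of_neg M X Xstar \<longleftrightarrow>
    prob_space.indep_var M path_space (path_of X) path_space (path_of Xstar) \<and>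
    distr M path_space (path_of Xstar) = distr M path_space (path_of (\<lambda>t \<omega>. - X t \<omega>))"

definition replica ::
  "(real \<Rightarrow> 'w \<Rightarrow> 'a::euclidean_space) \<Rightarrow> (real \<Rightarrow> 'w \<Rightarrow> 'a) \<Rightarrow> real \<Rightarrow> 'w \<Rightarrow> 'a"
  where "replica X Xstar t \<omega> = X t \<omega> + Xstar t \<omega>"

text \<open>Semigroup and resolvent of a process \<open>Y\<close>, acting on nonnegative functions.\<close>

definition transition_semigroup ::
  "'w measure \<Rightarrow> (real \<Rightarrow> 'w \<Rightarrow> 'a::euclidean_space) \<Rightarrow> real \<Rightarrow> ('a \<Rightarrow> ennreal) \<Rightarrow> 'a \<Rightarrow> ennreal"
  where "transition_semigroup M Y s \<phi> x = (\<integral>\<^sup>+\<omega>. \<phi> (x + Y s \<omega>) \<partial>M)"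

definition resolvent ::
  "'w measure \<Rightarrow> (real \<Rightarrow> 'w \<Rightarrow> 'a::euclidean_space) \<Rightarrow> real \<Rightarrow> ('a \<Rightarrow> ennreal) \<Rightarrow> 'a \<Rightarrow> ennreal"
  where "resolvent M Y \<alpha> \<phi> x =
    (\<integral>\<^sup>+s\<in>{0..}. ennreal (exp (- \<alpha> * s)) * transition_semigroup M Y s \<phi> x \<partial>lborel)"

definition Upsilon :: "('a::euclidean_space \<Rightarrow> ennreal) \<Rightarrow> ('a \<Rightarrow> complex) \<Rightarrow> real \<Rightarrow> ennreal"
  where "Upsilon fhat \<Psi> \<beta> =
    ennreal (1 / (2 * pi) ^ DIM('a)) *
      (\<integral>\<^sup>+\<xi>. fhat \<xi> / ennreal (\<beta> + 2 * Re (\<Psi> \<xi>)) \<partial>lborel)"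

end

theory Submission
  imports Defs
begin

text \<open>
  Let \<open>p\<close> be the density of \<open>X t\<close>. The replica at time \<open>t\<close> is the difference of two independent
  variables with density \<open>p\<close>, so the semigroup applied to \<open>f\<close> and evaluated at the origin is the
  energy \<open>\<integral>\<integral> p(y) p(z) f(y - z) dy dz\<close>. Formally, Parseval's identity turns it into
  \<open>(2 \<pi>)\<^sup>-\<^sup>d \<integral> fhat |Fourier p|\<^sup>2 = (2 \<pi>)\<^sup>-\<^sup>d \<integral> fhat(\<xi>) exp(- 2 t Re \<Psi>(\<xi>)) d\<xi>\<close>, and integrating
  over time gives \<open>\<Upsilon>\<close>.

  Parseval's identity is needed for an arbitrary density \<open>p\<close> and with values in \<open>[0, \<infinity>]\<close>
  (\<open>energy_eq_spectral_energy\<close>). If \<open>f\<close> is replaced by its convolution with a Gaussian, the identity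
  is Fubini's theorem (\<open>energy_mollify\<close>): the formula \<open>\<integral> fhat \<phi> = \<integral> f (Fourier \<phi>)\<close>, tested on a
  modulated Gaussian \<open>\<phi>\<close>, expresses the mollified function through \<open>fhat\<close>. As the width of the
  Gaussian shrinks, the Fourier side converges monotonically. The other side converges when \<open>p\<close> is
  bounded with bounded support, because the autocorrelation of such a \<open>p\<close> is a continuous function of
  bounded support and \<open>f\<close> integrates Gaussians (\<open>energy_mollify_tendsto\<close>). A general \<open>p\<close> is reached
  by truncation, with Fatou's lemma on the Fourier side.

  Other points \<open>x\<close> are treated by polarisation: the identity for \<open>p\<close> plus its translate by \<open>x\<close> gives,
  \<open>f\<close> being symmetric, that the values of the semigroup at \<open>0\<close> and at \<open>x\<close> add up to
  \<open>(2 \<pi>)\<^sup>-\<^sup>d \<integral> fhat(\<xi>) exp(- 2 t Re \<Psi>(\<xi>)) (1 + cos(x \<bullet> \<xi>)) d\<xi>\<close>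
  (\<open>shifted_energy_spectral\<close>). This holds at every point \<open>x\<close>, not merely almost everywhere, and for
  infinite values too. Integrating over time and using \<open>1 + cos \<le> 2\<close> shows that the resolvent is largest
  at the origin. If it is finite there, subtracting its value at \<open>0\<close> exhibits it as the cosine transform
  of the integrable function \<open>fhat / (\<beta> + 2 Re \<Psi>)\<close>, up to a constant factor, and the Riemann--Lebesgue
  lemma puts this transform in \<open>C0\<close> (\<open>resolvent_C0_version\<close>).
\<close>

section \<open>Modulated Gaussians are Schwartz functions\<close>

text \<open>The test functions against which \<open>f\<close> is paired below are the modulated Gaussians
  \<open>exp (- a |x|\<^sup>2 + i u \<bullet> x)\<close>. Their iterated partial derivatives are polynomials times the same
  exponential; the class generates these products without introducing multivariate polynomials.
  It is closed under differentiation, so rapid decrease of every derivative follows from rapid decrease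
  of the members of the class.\<close>

inductive gaussian_class :: "real \<Rightarrow> 'a::euclidean_space \<Rightarrow> ('a \<Rightarrow> complex) \<Rightarrow> bool" for a u where
  base: "gaussian_class a u (\<lambda>x. of_real (exp (- a * (x \<bullet> x))) * iexp (u \<bullet> x))"
| coord: "gaussian_class a u g \<Longrightarrow> gaussian_class a u (\<lambda>x. of_real (x \<bullet> c) * g x)"
| add: "gaussian_class a u g \<Longrightarrow> gaussian_class a u h \<Longrightarrow> gaussian_class a u (\<lambda>x. g x + h x)"
| scale: "gaussian_class a u g \<Longrightarrow> gaussian_class a u (\<lambda>x. z * g x)"

lemma gaussian_class_derivative:
  assumes "gaussian_class a u g"
  shows "\<exists>g'. (\<forall>x. (g has_derivative g' x) (at x)) \<and> (\<forall>b. gaussian_class a u (\<lambda>x. g' x b))"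
  using assms
proof induction
  case base
  let ?E = "\<lambda>x::'a. complex_of_real (exp (- a * (x \<bullet> x))) * iexp (u \<bullet> x)"
  let ?g' = "\<lambda>x b. (complex_of_real (- 2 * a) * (of_real (x \<bullet> b) * ?E x)) + (\<i> * of_real (u \<bullet> b)) * ?E x"
  have "(?E has_derivative ?g' x) (at x)" for x
  proof -
    have 1: "((\<lambda>x. complex_of_real (exp (- a * (x \<bullet> x)))) has_derivative
        (\<lambda>b. of_real (exp (- a * (x \<bullet> x)) * (- a * (2 * (x \<bullet> b)))))) (at x)"
      by (rule has_derivative_of_real) (auto intro!: derivative_eq_intros simp: inner_commute algebra_simps)
    have 3: "((\<lambda>x. \<i> * complex_of_real (u \<bullet> x)) has_derivative (\<lambda>b. \<i> * of_real (u \<bullet> b))) (at x)"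
      by (auto intro!: derivative_eq_intros)
    have 2: "((\<lambda>x. iexp (u \<bullet> x)) has_derivative
        (\<lambda>b. \<i> * of_real (u \<bullet> b) * iexp (u \<bullet> x))) (at x)"
      using has_derivative_compose[OF 3 DERIV_exp[unfolded has_field_derivative_def]]
      by (simp add: mult.commute)
    show ?thesis
      by (rule has_derivative_eq_rhs[OF has_derivative_mult[OF 1 2]]) (auto simp: algebra_simps)
  qed
  moreover have "gaussian_class a u (\<lambda>x. ?g' x b)" for b
    by (intro gaussian_class.intros)
  ultimately show ?case by (intro exI[of _ ?g']) blast
next
  case (coord g c)
  then obtain g' where g': "\<And>x. (g has_derivative g' x) (at x)" "\<And>b. gaussian_class a u (\<lambda>x. g' x b)" by blast
  have "((\<lambda>x. of_real (x \<bullet> c) * g x) has_derivative (\<lambda>b. of_real (x \<bullet> c) * g' x b + of_real (b \<bullet> c) * g x)) (at x)" for x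
  proof -
    have 1: "((\<lambda>x. complex_of_real (x \<bullet> c)) has_derivative (\<lambda>b. of_real (b \<bullet> c))) (at x)"
      by (intro has_derivative_of_real) (auto intro!: derivative_eq_intros)
    show ?thesis by (rule has_derivative_mult[OF 1 g'(1)])
  qed
  moreover have "gaussian_class a u (\<lambda>x. of_real (x \<bullet> c) * g' x b + of_real (b \<bullet> c) * g x)" for b
    by (intro gaussian_class.intros g' coord)
  ultimately show ?case
    by (intro exI[of _ "\<lambda>x b. of_real (x \<bullet> c) * g' x b + of_real (b \<bullet> c) * g x"]) blast
next
  case (add g h)
  then obtain g' h' where g': "\<And>x. (g has_derivative g' x) (at x)" "\<And>b. gaussian_class a u (\<lambda>x. g' x b)"
    and h': "\<And>x. (h has_derivative h' x) (at x)" "\<And>b. gaussian_class a u (\<lambda>x. h' x b)" by blast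
  show ?case
    by (intro exI[of _ "\<lambda>x b. g' x b + h' x b"] conjI allI has_derivative_add gaussian_class.intros g' h')
next
  case (scale g z)
  then obtain g' where g': "\<And>x. (g has_derivative g' x) (at x)" "\<And>b. gaussian_class a u (\<lambda>x. g' x b)" by blast
  show ?case
    by (intro exI[of _ "\<lambda>x b. z * g' x b"] conjI allI has_derivative_mult_right gaussian_class.intros g')
qed

lemma gaussian_class_iter_partial:
  assumes "gaussian_class a u g"
  shows "gaussian_class a u (iter_partial bs g)"
proof (induction bs)
  case Nil
  then show ?case using assms by (simp add: iter_partial_def)
next
  case (Cons b bs)
  obtain g' where g': "\<And>x. (iter_partial bs g has_derivative g' x) (at x)"
    "\<And>b. gaussian_class a u (\<lambda>x. g' x b)"
    using gaussian_class_derivative[OF Cons.IH] by blast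
  have "iter_partial (b # bs) g = (\<lambda>x. g' x b)"
    using frechet_derivative_at[OF g'(1)] by (simp add: iter_partial_def)
  then show ?case using g'(2) by simp
qed

lemma gaussian_times_power_bounded:
  fixes a :: real assumes "a > 0"
  shows "\<exists>B. \<forall>x::'a::euclidean_space. (1 + norm x) ^ k * exp (- a * (x \<bullet> x)) \<le> B"
proof -
  have "((\<lambda>t::real. (1 + t) ^ k * exp (- a * t\<^sup>2)) \<longlongrightarrow> 0) at_top"
  proof -
    have lim: "((\<lambda>t::real. (1 + t) ^ k / exp (1 + t)) \<longlongrightarrow> 0) at_top"
      by (rule filterlim_compose[OF tendsto_power_div_exp_0])
        (auto intro!: filterlim_tendsto_add_at_top filterlim_ident tendsto_const)
    have lim2: "((\<lambda>t::real. exp 1 * ((1 + t) ^ k / exp (1 + t))) \<longlongrightarrow> 0) at_top"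
      using tendsto_mult[OF tendsto_const lim, of "exp 1"] by (simp only: mult_zero_right)
    show ?thesis
    proof (rule tendsto_sandwich[OF _ _ tendsto_const lim2])
      show "\<forall>\<^sub>F t::real in at_top. 0 \<le> (1 + t) ^ k * exp (- a * t\<^sup>2)"
        using eventually_ge_at_top[of 0] by eventually_elim auto
      show "\<forall>\<^sub>F t::real in at_top. (1 + t) ^ k * exp (- a * t\<^sup>2) \<le> exp 1 * ((1 + t) ^ k / exp (1 + t))"
        using eventually_ge_at_top[of 0] eventually_ge_at_top[of "1 / a"]
      proof eventually_elim
        case (elim t)
        have "t \<le> a * t\<^sup>2"
          using elim assms mult_right_mono[of 1 "a * t" t] by (simp add: field_simps power2_eq_square)
        then have "exp (- a * t\<^sup>2) \<le> exp (- t)" by simp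
        also have "\<dots> = exp 1 / exp (1 + t)" by (simp add: exp_diff[symmetric])
        finally show ?case using elim by (simp add: mult_left_mono field_simps)
      qed
    qed
  qed
  then have "\<forall>\<^sub>F t::real in at_top. (1 + t) ^ k * exp (- a * t\<^sup>2) < 1"
    by (rule order_tendstoD) simp
  then obtain T where T: "\<And>t. t \<ge> T \<Longrightarrow> (1 + t) ^ k * exp (- a * t\<^sup>2) < 1"
    by (auto simp: eventually_at_top_linorder)
  have "continuous_on {0..max T 0} (\<lambda>t::real. (1 + t) ^ k * exp (- a * t\<^sup>2))"
    by (intro continuous_intros)
  then have "compact ((\<lambda>t::real. (1 + t) ^ k * exp (- a * t\<^sup>2)) ` {0..max T 0})"
    by (rule compact_continuous_image) simp
  then have "bdd_above ((\<lambda>t::real. (1 + t) ^ k * exp (- a * t\<^sup>2)) ` {0..max T 0})"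
    by (intro bounded_imp_bdd_above compact_imp_bounded)
  then obtain B where B: "\<And>t. t \<in> {0..max T 0} \<Longrightarrow> (1 + t) ^ k * exp (- a * t\<^sup>2) \<le> B"
    unfolding bdd_above_def by blast
  have "(1 + norm x) ^ k * exp (- a * (x \<bullet> x)) \<le> max 1 B" for x :: 'a
  proof (cases "norm x \<ge> T")
    case True
    then show ?thesis using T[OF True] by (simp add: power2_norm_eq_inner)
  next
    case False
    then have "norm x \<in> {0..max T 0}" by auto
    from B[OF this] show ?thesis by (simp add: power2_norm_eq_inner)
  qed
  then show ?thesis by blast
qed

text \<open>Multiplying by a coordinate costs one power of \<open>1 + norm x\<close>; since the bound is claimed for all
  powers at once, it is stable under every generating operation of the class.\<close>

lemma gaussian_class_rapidly_decreasing:
  fixes g :: "'a::euclidean_space \<Rightarrow> complex"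
  assumes "a > 0" and "gaussian_class a u g"
  shows "\<forall>k. bounded (range (\<lambda>x. (1 + norm x) ^ k *\<^sub>R g x))"
  using assms(2)
proof induction
  case base
  show ?case
  proof
    fix k
    obtain B where "\<And>x::'a. (1 + norm x) ^ k * exp (- a * (x \<bullet> x)) \<le> B"
      using gaussian_times_power_bounded[OF assms(1), of k] by blast
    then show "bounded (range (\<lambda>x. (1 + norm x) ^ k *\<^sub>R (complex_of_real (exp (- a * (x \<bullet> x))) * iexp (u \<bullet> x))))"
      by (auto simp: bounded_iff norm_mult simp del: of_real_exp)
  qed
next
  case (coord g c)
  show ?case
  proof
    fix k
    obtain B where B: "\<And>x::'a. norm ((1 + norm x) ^ Suc k *\<^sub>R g x) \<le> B"
      using coord.IH unfolding bounded_iff by (metis rangeI)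
    have "norm ((1 + norm x) ^ k *\<^sub>R (complex_of_real (x \<bullet> c) * g x)) \<le> norm c * B" for x
    proof -
      have "\<bar>x \<bullet> c\<bar> \<le> norm c * (1 + norm x)"
        using Cauchy_Schwarz_ineq2[of x c] by (simp add: algebra_simps add_increasing)
      then have "(1 + norm x) ^ k * (\<bar>x \<bullet> c\<bar> * norm (g x)) \<le> (1 + norm x) ^ k * ((norm c * (1 + norm x)) * norm (g x))"
        by (intro mult_left_mono mult_right_mono) auto
      also have "\<dots> = norm c * norm ((1 + norm x) ^ Suc k *\<^sub>R g x)"
        by simp
      also have "\<dots> \<le> norm c * B" using B by (intro mult_left_mono) auto
      finally show ?thesis by (simp add: norm_mult)
    qed
    then show "bounded (range (\<lambda>x. (1 + norm x) ^ k *\<^sub>R (complex_of_real (x \<bullet> c) * g x)))"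
      unfolding bounded_iff by blast
  qed
next
  case (add g h)
  then show ?case by (auto simp: scaleR_add_right intro!: bounded_plus_comp)
next
  case (scale g z)
  show ?case
  proof
    fix k
    have "bounded ((\<lambda>y. z * y) ` range (\<lambda>x. (1 + norm x) ^ k *\<^sub>R g x))"
      by (rule bounded_linear_image[OF spec[OF scale.IH] bounded_linear_mult_right])
    then show "bounded (range (\<lambda>x. (1 + norm x) ^ k *\<^sub>R (z * g x)))"
      by (simp add: image_image)
  qed
qed

lemma gaussian_class_schwartz:
  assumes "a > 0" and "gaussian_class a u g"
  shows "schwartz g"
  unfolding schwartz_def
proof safe
  fix bs :: "'a list"
  have *: "gaussian_class a u (iter_partial bs g)"
    by (rule gaussian_class_iter_partial[OF assms(2)])
  show "iter_partial bs g differentiable_on UNIV"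
    using gaussian_class_derivative[OF *] by (auto simp: differentiable_on_def differentiable_def)
  show "bounded (range (\<lambda>x. (1 + norm x) ^ k *\<^sub>R iter_partial bs g x))" for k
    using gaussian_class_rapidly_decreasing[OF assms(1) *] by blast
qed

section \<open>Fourier transforms of Gaussians\<close>

text \<open>The density of the centred normal law with covariance \<open>s\<^sup>2\<close> times the identity.\<close>

definition gauss :: "real \<Rightarrow> 'a::euclidean_space \<Rightarrow> real" where
  "gauss s z = (\<Prod>b\<in>Basis. normal_density 0 s (z \<bullet> b))"

lemma gauss_nonneg: "gauss s z \<ge> 0"
  by (simp add: gauss_def prod_nonneg)

lemma borel_measurable_gauss [measurable]: "gauss s \<in> borel_measurable borel"
  unfolding gauss_def[abs_def] by measurable

lemma gauss_minus: "gauss s (- z) = gauss s z"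
  by (simp add: gauss_def normal_density_def)

lemma nn_integral_gauss:
  assumes "s > 0"
  shows "(\<integral>\<^sup>+z. ennreal (gauss s z) \<partial>(lborel :: 'a::euclidean_space measure)) = 1"
proof -
  have "(\<integral>\<^sup>+x. normal_density 0 s x \<partial>lborel) = 1"
    using assms by (simp add: nn_integral_eq_integral)
  then show ?thesis
    unfolding gauss_def
    by (simp only: prod_ennreal[symmetric] normal_density_nonneg)
      (subst nn_integral_lborel_prod, simp_all)
qed

lemma gauss_eq_exp:
  fixes z :: "'a::euclidean_space"
  assumes "s > 0"
  shows "gauss s z = exp (- (z \<bullet> z) / (2 * s\<^sup>2)) / sqrt (2 * pi * s\<^sup>2) ^ DIM('a)"
  unfolding gauss_def normal_density_def
  by (simp add: prod_dividef exp_sum[symmetric] euclidean_inner[of z z] power2_eq_square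
      sum_divide_distrib sum_negf prod.distrib power_one_over divide_simps)

lemma gauss_rescale:
  fixes v :: "'a::euclidean_space"
  assumes "s > 0"
  shows "gauss s (s *\<^sub>R v) * s ^ DIM('a) = gauss 1 v"
  using assms by (simp add: gauss_eq_exp real_sqrt_mult power_mult_distrib power2_eq_square)

text \<open>Up to scaling this is the characteristic function of the standard normal distribution.\<close>

lemma fourier_gaussian_real:
  fixes s z :: real
  assumes s: "s > 0"
  shows "integrable lborel (\<lambda>x. of_real (exp (- s\<^sup>2 * x\<^sup>2 / 2)) * iexp (z * x))"
    and "(LINT x|lborel. of_real (exp (- s\<^sup>2 * x\<^sup>2 / 2)) * iexp (z * x)) = of_real (2 * pi * normal_density 0 s z)"
proof -
  let ?f = "\<lambda>x. of_real (std_normal_density x) * iexp ((z / s) * x)"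
  have int: "integrable lborel ?f"
    by (rule Bochner_Integration.integrable_bound[OF integrable_normal_density[of 1 0]])
      (auto simp: norm_mult)
  have ch: "char std_normal_distribution (z / s) = (LINT x|lborel. ?f x)"
    unfolding char_def by (subst integral_density) (auto simp: scaleR_conv_of_real)
  have val: "(LINT x|lborel. ?f x) = of_real (exp (- (z / s)\<^sup>2 / 2))"
    by (rule trans[OF ch[symmetric]]) (simp only: char_std_normal_distribution)
  have eq: "of_real (exp (- s\<^sup>2 * x\<^sup>2 / 2)) * iexp (z * x) = of_real (sqrt (2 * pi)) * ?f (0 + s * x)" for x
    using s by (simp add: std_normal_density_def power_mult_distrib field_simps)
  have hb: "has_bochner_integral lborel (\<lambda>x. ?f (0 + s * x)) ((LINT x|lborel. ?f x) /\<^sub>R \<bar>s\<bar>)"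
    using s int lborel_has_bochner_integral_real_affine_iff[of s ?f "LINT x|lborel. ?f x" 0]
    by (auto simp: has_bochner_integral_iff)
  then show "integrable lborel (\<lambda>x. of_real (exp (- s\<^sup>2 * x\<^sup>2 / 2)) * iexp (z * x))"
    unfolding eq by (intro integrable_mult_right) (auto simp: has_bochner_integral_iff)
  have "(LINT x|lborel. of_real (exp (- s\<^sup>2 * x\<^sup>2 / 2)) * iexp (z * x))
      = of_real (sqrt (2 * pi)) * ((LINT x|lborel. ?f x) /\<^sub>R \<bar>s\<bar>)"
    unfolding eq using hb by (simp add: has_bochner_integral_iff)
  also have "\<dots> = of_real (sqrt (2 * pi) / s * exp (- (z / s)\<^sup>2 / 2))"
    unfolding val using s by (simp add: scaleR_conv_of_real divide_simps)
  also have "sqrt (2 * pi) / s * exp (- (z / s)\<^sup>2 / 2) = 2 * pi * normal_density 0 s z"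
  proof -
    have q: "2 * pi * (E / (q * s)) = q / s * E" if "q * q = 2 * pi" "q > 0" for q E :: real
      using that(2) s unfolding that(1)[symmetric] by (simp add: divide_simps)
    have nd: "normal_density 0 s z = exp (- (z / s)\<^sup>2 / 2) / (sqrt (2 * pi) * s)"
      using s by (simp add: normal_density_def real_sqrt_mult power_divide)
    show ?thesis
      unfolding nd by (rule q[symmetric]) auto
  qed
  finally show "(LINT x|lborel. of_real (exp (- s\<^sup>2 * x\<^sup>2 / 2)) * iexp (z * x)) = of_real (2 * pi * normal_density 0 s z)" .
qed

text \<open>Lebesgue measure is the product of its one-dimensional marginals, so that integrals of products of
  functions of one coordinate factorise.\<close>

lemma lborel_integral_prod_Basis:
  fixes F :: "'a::euclidean_space \<Rightarrow> real \<Rightarrow> complex"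
  assumes "\<And>b. b \<in> Basis \<Longrightarrow> integrable lborel (F b)"
  shows "(LINT x|lborel. (\<Prod>b\<in>Basis. F b (x \<bullet> b))) = (\<Prod>b\<in>Basis. (LINT t|lborel. F b t))"
proof -
  interpret product_sigma_finite "\<lambda>b::'a. lborel :: real measure" ..
  have [measurable]: "\<And>b. b \<in> Basis \<Longrightarrow> F b \<in> borel_measurable borel"
    using borel_measurable_integrable[OF assms] by simp
  have "(LINT x|lborel. (\<Prod>b\<in>Basis. F b (x \<bullet> b)))
      = (LINT x|Pi\<^sub>M Basis (\<lambda>b::'a. lborel :: real measure). (\<Prod>b\<in>Basis. F b ((\<Sum>c\<in>Basis. x c *\<^sub>R c) \<bullet> b)))"
    by (subst lborel_eq) (rule integral_distr; measurable)
  also have "\<dots> = (LINT x|Pi\<^sub>M Basis (\<lambda>b::'a. lborel :: real measure). (\<Prod>b\<in>Basis. F b (x b)))"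
    by (intro Bochner_Integration.integral_cong prod.cong refl) (simp add: inner_sum_left inner_Basis if_distrib cong: if_cong)
  also have "\<dots> = (\<Prod>b\<in>Basis. (LINT t|lborel. F b t))"
    by (rule product_integral_prod) (auto intro: assms)
  finally show ?thesis .
qed

text \<open>A Gaussian modulated by frequency \<open>u\<close> is carried by the Fourier transform to a multiple of the
  Gaussian density centred at \<open>- u\<close>. Pairing \<open>fhat\<close> with the former therefore mollifies \<open>f\<close>
  at the scale \<open>s\<close>.\<close>

lemma fourier_gaussian:
  fixes u y :: "'a::euclidean_space"
  assumes s: "s > 0"
  shows "fourier (\<lambda>\<xi>. of_real (exp (- (s\<^sup>2 / 2) * (\<xi> \<bullet> \<xi>))) * iexp (u \<bullet> \<xi>)) y
    = of_real ((2 * pi) ^ DIM('a) * gauss s (u + y))"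
proof -
  have "fourier (\<lambda>\<xi>. of_real (exp (- (s\<^sup>2 / 2) * (\<xi> \<bullet> \<xi>))) * iexp (u \<bullet> \<xi>)) y
     = (LINT \<xi>|lborel. (\<Prod>b\<in>Basis. of_real (exp (- s\<^sup>2 * (\<xi> \<bullet> b)\<^sup>2 / 2)) * iexp (((u + y) \<bullet> b) * (\<xi> \<bullet> b))))"
    unfolding fourier_def
  proof (intro Bochner_Integration.integral_cong refl)
    fix \<xi> :: 'a
    have 1: "(\<Prod>b\<in>Basis. complex_of_real (exp (- s\<^sup>2 * (\<xi> \<bullet> b)\<^sup>2 / 2))) = of_real (exp (- (s\<^sup>2 / 2) * (\<xi> \<bullet> \<xi>)))"
      unfolding of_real_prod[symmetric] exp_sum[OF finite_Basis, symmetric] euclidean_inner[of \<xi> \<xi>]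
      by (simp add: sum_distrib_left power2_eq_square sum_negf sum_divide_distrib)
    have 2: "(\<Prod>b\<in>Basis. iexp (((u + y) \<bullet> b) * (\<xi> \<bullet> b))) = iexp (u \<bullet> \<xi>) * iexp (\<xi> \<bullet> y)"
      unfolding exp_sum[OF finite_Basis, symmetric] exp_add[symmetric] inner_commute[of \<xi> y]
        distrib_left[symmetric] sum_distrib_left[symmetric] of_real_add[symmetric] inner_add_left[symmetric]
        of_real_sum[symmetric] euclidean_inner[of "u + y" \<xi>] ..
    show "iexp (\<xi> \<bullet> y) * (of_real (exp (- (s\<^sup>2 / 2) * (\<xi> \<bullet> \<xi>))) * iexp (u \<bullet> \<xi>))
      = (\<Prod>b\<in>Basis. of_real (exp (- s\<^sup>2 * (\<xi> \<bullet> b)\<^sup>2 / 2)) * iexp (((u + y) \<bullet> b) * (\<xi> \<bullet> b)))"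
      unfolding prod.distrib 1 2 by (simp only: ac_simps)
  qed
  also have "\<dots> = (\<Prod>b\<in>Basis. (LINT x|lborel. of_real (exp (- s\<^sup>2 * x\<^sup>2 / 2)) * iexp (((u + y) \<bullet> b) * x)))"
    by (rule lborel_integral_prod_Basis) (rule fourier_gaussian_real(1)[OF s])
  also have "\<dots> = of_real ((2 * pi) ^ DIM('a) * gauss s (u + y))"
    unfolding fourier_gaussian_real(2)[OF s] gauss_def
    by (simp add: prod.distrib)
  finally show ?thesis .
qed

section \<open>Continuity of translations in the mean\<close>

lemma lborel_translate:
  fixes h :: "'a::euclidean_space" and g :: "'a \<Rightarrow> 'b::{banach, second_countable_topology}"
  shows "integrable lborel g \<Longrightarrow> integrable lborel (\<lambda>x. g (x + h))"
    and "(LINT x|lborel. g (x + h)) = (LINT x|lborel. g x)"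
proof -
  have eq: "distr lborel borel (\<lambda>x. x + h) = (lborel :: 'a measure)"
    using lborel_distr_plus[of h] by (simp add: add.commute[of _ h] cong: distr_cong)
  show "integrable lborel (\<lambda>x. g (x + h))" if "integrable lborel g"
    using that integrable_distr[of "\<lambda>x. x + h" lborel borel g] by (simp add: eq)
  show "(LINT x|lborel. g (x + h)) = (LINT x|lborel. g x)"
  proof (cases "g \<in> borel_measurable borel")
    case True
    then show ?thesis using integral_distr[of "\<lambda>x. x + h" lborel borel g] by (simp add: eq)
  next
    case False
    have "(\<lambda>x. g (x + h)) \<notin> borel_measurable borel"
    proof
      assume [measurable]: "(\<lambda>x. g (x + h)) \<in> borel_measurable borel"
      have "(\<lambda>x. (\<lambda>x. g (x + h)) (x - h)) \<in> borel_measurable borel" by measurable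
      with False show False by simp
    qed
    with False show ?thesis
      by (metis borel_measurable_integrable measurable_lborel2 not_integrable_integral_eq)
  qed
qed

lemma nn_integral_lborel_translate:
  fixes h :: "'a::euclidean_space"
  assumes [measurable]: "g \<in> borel_measurable borel"
  shows "(\<integral>\<^sup>+x. g (x + h) \<partial>lborel) = (\<integral>\<^sup>+x. g x \<partial>lborel)"
proof -
  have "distr lborel borel (\<lambda>x. x + h) = (lborel :: 'a measure)"
    using lborel_distr_plus[of h] by (simp add: add.commute[of _ h] cong: distr_cong)
  then show ?thesis using nn_integral_distr[of "\<lambda>x. x + h" lborel borel g] by simp
qed

text \<open>The property is named because it is established for larger and larger classes of functions: first
  continuous ones of compact support, then their limits in \<open>L\<^sup>1\<close>.\<close>

definition L1_continuous_translation :: "('a::euclidean_space \<Rightarrow> real) \<Rightarrow> bool" where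
  "L1_continuous_translation g \<longleftrightarrow> ((\<lambda>h. LINT x|lborel. \<bar>g (x + h) - g x\<bar>) \<longlongrightarrow> 0) (nhds 0)"

lemma L1_continuous_translation_compact_support:
  fixes g :: "'a::euclidean_space \<Rightarrow> real"
  assumes cont: "continuous_on UNIV g" and supp: "\<And>x. norm x > R \<Longrightarrow> g x = 0"
    and bd: "\<And>x. \<bar>g x\<bar> \<le> B"
  shows "L1_continuous_translation g"
proof -
  have [measurable]: "g \<in> borel_measurable borel"
    by (rule borel_measurable_continuous_onI[OF cont])
  have "(\<lambda>n. LINT x|lborel. \<bar>g (x + h n) - g x\<bar>) \<longlonglongrightarrow> 0" if h: "h \<longlonglongrightarrow> 0" for h :: "nat \<Rightarrow> 'a"
  proof -
    obtain K where K: "\<And>n. norm (h n) \<le> K"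
      using convergent_imp_Bseq[of h] h by (auto simp: Bseq_def convergent_def)
    have "K \<ge> 0" using K[of 0] norm_ge_zero[of "h 0"] by linarith
    have "B \<ge> 0" using bd[of 0] by linarith
    have "(\<lambda>n. LINT x|lborel. \<bar>g (x + h n) - g x\<bar>) \<longlonglongrightarrow> (LINT (x::'a)|lborel. 0)"
    proof (rule integral_dominated_convergence[where w="\<lambda>x. (2 * B) * indicator (cball 0 (R + K)) x"])
      show "integrable lborel (\<lambda>x::'a. (2 * B) * indicator (cball 0 (R + K)) x)"
        by (intro integrable_mult_right integrable_real_indicator) (auto simp: less_top[symmetric] emeasure_lborel_cball_finite[unfolded infinity_ennreal_def less_top[symmetric]])
      show "AE x in lborel. (\<lambda>n. \<bar>g (x + h n) - g x\<bar>) \<longlonglongrightarrow> 0"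
      proof (intro AE_I2)
        fix x :: 'a
        have "(\<lambda>n. x + h n) \<longlonglongrightarrow> x" using tendsto_add[OF tendsto_const h, of x] by simp
        then have "(\<lambda>n. g (x + h n)) \<longlonglongrightarrow> g x"
          using cont by (intro continuous_on_tendsto_compose[OF cont]) auto
        then have "(\<lambda>n. \<bar>g (x + h n) - g x\<bar>) \<longlonglongrightarrow> \<bar>g x - g x\<bar>"
          by (intro tendsto_intros)
        then show "(\<lambda>n. \<bar>g (x + h n) - g x\<bar>) \<longlonglongrightarrow> 0" by simp
      qed
      show "AE x in lborel. norm \<bar>g (x + h n) - g x\<bar> \<le> (2 * B) * indicator (cball 0 (R + K)) x" for n
      proof (intro AE_I2)
        fix x :: 'a
        show "norm \<bar>g (x + h n) - g x\<bar> \<le> (2 * B) * indicator (cball 0 (R + K)) x"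
        proof (cases "norm x \<le> R + K")
          case True
          then show ?thesis using bd[of "x + h n"] bd[of x] by (simp add: indicator_def)
        next
          case False
          have "norm x \<le> norm (x + h n) + norm (h n)"
            using norm_triangle_ineq4[of "x + h n" "h n"] by simp
          then have "norm (x + h n) > R" "norm x > R" using False K[of n] \<open>K \<ge> 0\<close> by auto
          then show ?thesis using supp \<open>B \<ge> 0\<close> by simp
        qed
      qed
    qed measurable
    then show ?thesis by simp
  qed
  then show ?thesis
    unfolding L1_continuous_translation_def tendsto_nhds_iff tendsto_at_iff_sequentially
    by (auto simp: comp_def)
qed

text \<open>Translations are isometries of \<open>L\<^sup>1\<close>, so the property passes to limits by splitting the error
  into three parts.\<close>

lemma L1_continuous_translation_closed:
  fixes g :: "'a::euclidean_space \<Rightarrow> real" and c :: "nat \<Rightarrow> 'a \<Rightarrow> real"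
  assumes g: "integrable lborel g" and c: "\<And>n. integrable lborel (c n)"
    and trans: "\<And>n. L1_continuous_translation (c n)"
    and lim: "(\<lambda>n. LINT x|lborel. \<bar>c n x - g x\<bar>) \<longlonglongrightarrow> 0"
  shows "L1_continuous_translation g"
  unfolding L1_continuous_translation_def
proof (rule tendstoI)
  fix e :: real assume "e > 0"
  then have "\<forall>\<^sub>F n in sequentially. (LINT x|lborel. \<bar>c n x - g x\<bar>) < e / 3"
    using lim by (intro order_tendstoD) auto
  then obtain n where n: "(LINT x|lborel. \<bar>c n x - g x\<bar>) < e / 3"
    by (auto simp: eventually_sequentially)
  have "\<forall>\<^sub>F h in nhds 0. (LINT x|lborel. \<bar>c n (x + h) - c n x\<bar>) < e / 3"
    using trans[of n] \<open>e > 0\<close> unfolding L1_continuous_translation_def by (intro order_tendstoD) auto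
  then show "\<forall>\<^sub>F h in nhds 0. dist (LINT x|lborel. \<bar>g (x + h) - g x\<bar>) 0 < e"
  proof eventually_elim
    case (elim h)
    have i: "integrable lborel (\<lambda>x. c n (x + h))" "integrable lborel (\<lambda>x. g (x + h))"
      using lborel_translate(1) c g by blast+
    have "(LINT x|lborel. \<bar>g (x + h) - g x\<bar>) \<le> (LINT x|lborel. \<bar>c n (x + h) - g (x + h)\<bar> +
        \<bar>c n (x + h) - c n x\<bar> + \<bar>c n x - g x\<bar>)"
      by (intro integral_mono Bochner_Integration.integrable_add Bochner_Integration.integrable_diff
          integrable_abs i c g) auto
    also have "\<dots> = (LINT x|lborel. \<bar>c n (x + h) - g (x + h)\<bar>) + (LINT x|lborel. \<bar>c n (x + h) - c n x\<bar>)
        + (LINT x|lborel. \<bar>c n x - g x\<bar>)"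
      by (subst Bochner_Integration.integral_add, intro Bochner_Integration.integrable_add Bochner_Integration.integrable_diff
          integrable_abs i c g, intro Bochner_Integration.integrable_diff integrable_abs i c g)
        (subst Bochner_Integration.integral_add, auto intro!: i c g)
    also have "(LINT x|lborel. \<bar>c n (x + h) - g (x + h)\<bar>) = (LINT x|lborel. \<bar>c n x - g x\<bar>)"
      by (rule lborel_translate(2)[of "\<lambda>x. \<bar>c n x - g x\<bar>"])
    finally show ?case using n elim by simp
  qed
qed

lemma L1_tendsto_dominated:
  fixes g w :: "'a \<Rightarrow> real" and c :: "nat \<Rightarrow> 'a \<Rightarrow> real"
  assumes [measurable]: "g \<in> borel_measurable M" "\<And>n. c n \<in> borel_measurable M"
    and w: "integrable M w"
    and lim: "AE x in M. (\<lambda>n. c n x) \<longlonglongrightarrow> g x"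
    and dom: "\<And>n. AE x in M. \<bar>c n x\<bar> \<le> w x" and domg: "AE x in M. \<bar>g x\<bar> \<le> w x"
  shows "(\<lambda>n. LINT x|M. \<bar>c n x - g x\<bar>) \<longlonglongrightarrow> 0"
proof -
  have "(\<lambda>n. LINT x|M. \<bar>c n x - g x\<bar>) \<longlonglongrightarrow> (LINT x|M. 0)"
  proof (rule integral_dominated_convergence[where w="\<lambda>x. 2 * w x"])
    show "AE x in M. (\<lambda>n. \<bar>c n x - g x\<bar>) \<longlonglongrightarrow> 0"
      using lim
    proof eventually_elim
      case (elim x)
      then have "(\<lambda>n. \<bar>c n x - g x\<bar>) \<longlonglongrightarrow> \<bar>g x - g x\<bar>" by (intro tendsto_intros)
      then show ?case by simp
    qed
    show "AE x in M. norm \<bar>c n x - g x\<bar> \<le> 2 * w x" for n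
      using dom[of n] domg by eventually_elim auto
  qed (use w in auto)
  then show ?thesis by simp
qed

text \<open>A measurable function is an almost everywhere limit of continuous functions, but with no control on
  their size. Truncating the values at \<open>m\<close> and cutting off outside the ball of radius \<open>m + 1\<close>
  makes dominated convergence applicable, and the truncations converge to \<open>g\<close> in \<open>L\<^sup>1\<close>.\<close>

lemma L1_continuous_translation_integrable:
  fixes g :: "'a::euclidean_space \<Rightarrow> real"
  assumes g: "integrable lborel g"
  shows "L1_continuous_translation g"
proof -
  have [measurable]: "g \<in> borel_measurable borel" using g by auto
  have "g \<in> borel_measurable lebesgue"
    by (rule measurable_completion) simp
  then have "g measurable_on UNIV"
    by (rule lebesgue_measurable_imp_measurable_on) simp
  then obtain N c where N: "negligible N" and c: "\<And>n. continuous_on UNIV (c n)"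
    and lim: "\<And>x. x \<notin> N \<Longrightarrow> (\<lambda>n. c n x) \<longlonglongrightarrow> g x"
    unfolding measurable_on_def by auto
  have [measurable]: "c n \<in> borel_measurable borel" for n
    by (rule borel_measurable_continuous_onI[OF c])
  have "AE x in lebesgue. (\<lambda>n. c n x) \<longlonglongrightarrow> g x"
    using N lim by (intro AE_I'[of N]) (auto simp: negligible_iff_null_sets)
  then have AElim: "AE x in lborel. (\<lambda>n. c n x) \<longlonglongrightarrow> g x"
    by (simp add: AE_completion_iff)
  define T where "T m t = max (- real m) (min (real m) t)" for m :: nat and t :: real
  define cutoff where "cutoff m x = max 0 (min 1 (real m + 1 - norm x))" for m :: nat and x :: 'a
  have [measurable]: "T m \<in> borel_measurable borel" "cutoff m \<in> borel_measurable borel" for m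
    unfolding T_def[abs_def] cutoff_def[abs_def] by measurable
  have contT: "continuous_on UNIV (T m)" and contcutoff: "continuous_on UNIV (cutoff m)" for m
    unfolding T_def[abs_def] cutoff_def[abs_def] by (intro continuous_intros)+
  have T: "\<bar>T m t\<bar> \<le> real m" "\<bar>T m t\<bar> \<le> \<bar>t\<bar>" for m t
    unfolding T_def by auto
  have cutoff: "0 \<le> cutoff m x" "cutoff m x \<le> 1" "norm x > real m + 1 \<Longrightarrow> cutoff m x = 0" for m x
    unfolding cutoff_def by auto
  have bound: "\<bar>T m t * cutoff m x\<bar> \<le> real m * indicator (cball 0 (real m + 1)) x" for m t x
    using T(1)[of m t] cutoff[of m x] mult_mono[of "\<bar>T m t\<bar>" "real m" "cutoff m x" 1]
    by (auto simp: indicator_def abs_mult)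
  have intw: "integrable lborel (\<lambda>x::'a. real m * indicator (cball 0 (real m + 1)) x)" for m
    by (intro integrable_mult_right integrable_real_indicator) (auto simp: less_top[symmetric] emeasure_lborel_cball_finite[unfolded infinity_ennreal_def less_top[symmetric]])
  have int: "integrable lborel (\<lambda>x. T m (k x) * cutoff m x)" if [measurable]: "k \<in> borel_measurable borel" for k m
    by (rule Bochner_Integration.integrable_bound[OF intw[of m]]) (use bound in auto)
  have step: "L1_continuous_translation (\<lambda>x. T m (g x) * cutoff m x)" for m
  proof (rule L1_continuous_translation_closed[where c="\<lambda>n x. T m (c n x) * cutoff m x"])
    show "integrable lborel (\<lambda>x. T m (g x) * cutoff m x)" "\<And>n. integrable lborel (\<lambda>x. T m (c n x) * cutoff m x)"
      by (auto intro: int)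
    show "L1_continuous_translation (\<lambda>x. T m (c n x) * cutoff m x)" for n
    proof (rule L1_continuous_translation_compact_support)
      show "continuous_on UNIV (\<lambda>x. T m (c n x) * cutoff m x)"
        by (intro continuous_on_mult contcutoff continuous_on_compose2[OF contT c]) auto
      show "norm x > real m + 1 \<Longrightarrow> T m (c n x) * cutoff m x = 0" for x by (simp add: cutoff)
      show "\<bar>T m (c n x) * cutoff m x\<bar> \<le> real m" for x
        by (rule order_trans[OF bound]) (auto simp: indicator_def)
    qed
    show "(\<lambda>n. LINT x|lborel. \<bar>T m (c n x) * cutoff m x - T m (g x) * cutoff m x\<bar>) \<longlonglongrightarrow> 0"
    proof (rule L1_tendsto_dominated[OF _ _ intw[of m]])
      show "AE x in lborel. (\<lambda>n. T m (c n x) * cutoff m x) \<longlonglongrightarrow> T m (g x) * cutoff m x"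
        using AElim by eventually_elim (intro tendsto_intros continuous_on_tendsto_compose[OF contT]; simp)
    qed (use bound in auto)
  qed
  show ?thesis
  proof (rule L1_continuous_translation_closed[OF g _ step])
    show "integrable lborel (\<lambda>x. T m (g x) * cutoff m x)" for m by (auto intro: int)
    show "(\<lambda>m. LINT x|lborel. \<bar>T m (g x) * cutoff m x - g x\<bar>) \<longlonglongrightarrow> 0"
    proof (rule L1_tendsto_dominated[where w="\<lambda>x. \<bar>g x\<bar>"])
      show "AE x in lborel. (\<lambda>m. T m (g x) * cutoff m x) \<longlonglongrightarrow> g x"
      proof (intro AE_I2 tendsto_eventually)
        fix x
        show "\<forall>\<^sub>F m in sequentially. T m (g x) * cutoff m x = g x"
          using eventually_ge_at_top[of "nat \<lceil>max \<bar>g x\<bar> (norm x)\<rceil>"]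
        proof eventually_elim
          case (elim m)
          then have "\<bar>g x\<bar> \<le> real m" "norm x \<le> real m" by linarith+
          then show ?case unfolding T_def cutoff_def by auto
        qed
      qed
      have "\<bar>T m (g x) * cutoff m x\<bar> \<le> \<bar>g x\<bar>" for m x
        using T(2)[of m "g x"] cutoff[of m x] mult_mono[of "\<bar>T m (g x)\<bar>" "\<bar>g x\<bar>" "cutoff m x" 1]
        by (auto simp: abs_mult)
      then show "AE x in lborel. \<bar>T m (g x) * cutoff m x\<bar> \<le> \<bar>g x\<bar>" for m by auto
    qed (use g in auto)
  qed
qed

section \<open>The Riemann--Lebesgue lemma\<close>

lemma integrable_times_cos:
  fixes h :: "'a::euclidean_space \<Rightarrow> real"
  assumes "integrable lborel h"
  shows "integrable lborel (\<lambda>\<xi>. h \<xi> * cos (x \<bullet> \<xi>))"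
proof (rule Bochner_Integration.integrable_bound[OF assms])
  show "(\<lambda>\<xi>. h \<xi> * cos (x \<bullet> \<xi>)) \<in> borel_measurable lborel" using assms by measurable
  show "AE \<xi> in lborel. norm (h \<xi> * cos (x \<bullet> \<xi>)) \<le> norm (h \<xi>)"
    by (auto simp: abs_mult intro!: mult_left_le)
qed

text \<open>Moving the integration variable by \<open>\<pi> x / |x|\<^sup>2\<close> changes the sign of the cosine. Averaging the two
  expressions bounds the integral by half the \<open>L\<^sup>1\<close> distance between \<open>h\<close> and a translate of it
  whose displacement vanishes as \<open>x\<close> tends to infinity.\<close>

lemma Riemann_Lebesgue_C0:
  fixes h :: "'a::euclidean_space \<Rightarrow> real"
  assumes h: "integrable lborel h"
  shows "(\<lambda>x. LINT \<xi>|lborel. h \<xi> * cos (x \<bullet> \<xi>)) \<in> C0"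
proof -
  have [measurable]: "h \<in> borel_measurable borel" using h by auto
  let ?I = "\<lambda>x. LINT \<xi>|lborel. h \<xi> * cos (x \<bullet> \<xi>)"
  have cont: "continuous_on UNIV ?I"
  proof (intro continuous_at_imp_continuous_on ballI)
    fix x :: 'a
    have "(\<lambda>n. ?I (X n)) \<longlonglongrightarrow> ?I x" if X: "X \<longlonglongrightarrow> x" for X
    proof (rule integral_dominated_convergence[where w="\<lambda>\<xi>. \<bar>h \<xi>\<bar>"])
      show "AE \<xi> in lborel. (\<lambda>n. h \<xi> * cos (X n \<bullet> \<xi>)) \<longlonglongrightarrow> h \<xi> * cos (x \<bullet> \<xi>)"
        by (intro AE_I2 tendsto_intros X)
      show "AE \<xi> in lborel. norm (h \<xi> * cos (X n \<bullet> \<xi>)) \<le> \<bar>h \<xi>\<bar>" for n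
        by (auto simp: abs_mult intro!: mult_left_le)
    qed (use h in auto)
    then show "isCont ?I x" by (auto simp: continuous_at_sequentially comp_def)
  qed
  have "(?I \<longlongrightarrow> 0) at_infinity"
  proof -
    let ?\<eta> = "\<lambda>x::'a. (pi / (x \<bullet> x)) *\<^sub>R x"
    have \<eta>: "filterlim ?\<eta> (nhds 0) at_infinity"
    proof (rule tendsto_norm_zero_cancel)
      have "((\<lambda>x::'a. pi * inverse (norm x)) \<longlongrightarrow> pi * 0) at_infinity"
        by (intro tendsto_intros tendsto_inverse_0_at_top) (simp add: filterlim_norm_at_top)
      moreover have "norm (?\<eta> x) = pi * inverse (norm x)" for x :: 'a
        by (cases "x = 0") (auto simp: dot_square_norm power2_eq_square divide_simps)
      ultimately show "((\<lambda>x. norm (?\<eta> x)) \<longlongrightarrow> 0) at_infinity" by simp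
    qed
    have lim: "((\<lambda>x. LINT \<xi>|lborel. \<bar>h (\<xi> + ?\<eta> x) - h \<xi>\<bar>) \<longlongrightarrow> 0) at_infinity"
      using L1_continuous_translation_integrable[OF h] unfolding L1_continuous_translation_def
      by (rule filterlim_compose[OF _ \<eta>])
    show ?thesis
    proof (rule Lim_null_comparison[OF _ lim])
      have "norm (?I x) \<le> (LINT \<xi>|lborel. \<bar>h (\<xi> + ?\<eta> x) - h \<xi>\<bar>)" if "x \<noteq> 0" for x
      proof -
        have i: "integrable lborel (\<lambda>\<xi>. h (\<xi> + ?\<eta> x))" by (rule lborel_translate(1)[OF h])
        have "?I x = (LINT \<xi>|lborel. h (\<xi> + ?\<eta> x) * cos (x \<bullet> (\<xi> + ?\<eta> x)))"
          by (rule lborel_translate(2)[symmetric, of "\<lambda>\<xi>. h \<xi> * cos (x \<bullet> \<xi>)"])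
        also have "\<dots> = (LINT \<xi>|lborel. - (h (\<xi> + ?\<eta> x) * cos (x \<bullet> \<xi>)))"
          using that by (intro Bochner_Integration.integral_cong) (auto simp: inner_add_right)
        also have "\<dots> = - (LINT \<xi>|lborel. h (\<xi> + ?\<eta> x) * cos (x \<bullet> \<xi>))"
          by simp
        finally have "2 * ?I x = ?I x - (LINT \<xi>|lborel. h (\<xi> + ?\<eta> x) * cos (x \<bullet> \<xi>))" by simp
        also have "\<dots> = (LINT \<xi>|lborel. h \<xi> * cos (x \<bullet> \<xi>) - h (\<xi> + ?\<eta> x) * cos (x \<bullet> \<xi>))"
          by (intro Bochner_Integration.integral_diff[symmetric] integrable_times_cos h i)
        finally have "2 * norm (?I x) = norm (LINT \<xi>|lborel. h \<xi> * cos (x \<bullet> \<xi>) - h (\<xi> + ?\<eta> x) * cos (x \<bullet> \<xi>))"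
          by (metis abs_mult abs_numeral real_norm_def)
        also have "\<dots> \<le> (LINT \<xi>|lborel. \<bar>h (\<xi> + ?\<eta> x) - h \<xi>\<bar>)"
        proof (rule Bochner_Integration.integral_norm_bound_integral)
          show "integrable lborel (\<lambda>\<xi>. h \<xi> * cos (x \<bullet> \<xi>) - h (\<xi> + ?\<eta> x) * cos (x \<bullet> \<xi>))"
            by (intro Bochner_Integration.integrable_diff integrable_times_cos h i)
          show "integrable lborel (\<lambda>\<xi>. \<bar>h (\<xi> + ?\<eta> x) - h \<xi>\<bar>)"
            by (intro integrable_abs Bochner_Integration.integrable_diff h i)
          show "norm (h \<xi> * cos (x \<bullet> \<xi>) - h (\<xi> + ?\<eta> x) * cos (x \<bullet> \<xi>)) \<le> \<bar>h (\<xi> + ?\<eta> x) - h \<xi>\<bar>" for \<xi>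
          proof -
            have "norm (h \<xi> * cos (x \<bullet> \<xi>) - h (\<xi> + ?\<eta> x) * cos (x \<bullet> \<xi>)) = \<bar>h (\<xi> + ?\<eta> x) - h \<xi>\<bar> * \<bar>cos (x \<bullet> \<xi>)\<bar>"
              by (simp add: left_diff_distrib[symmetric] abs_mult abs_minus_commute)
            also have "\<dots> \<le> \<bar>h (\<xi> + ?\<eta> x) - h \<xi>\<bar>" by (intro mult_left_le) auto
            finally show ?thesis .
          qed
        qed
        finally show ?thesis using norm_ge_zero[of "?I x"] by linarith
      qed
      then show "\<forall>\<^sub>F x in at_infinity. norm (?I x) \<le> (LINT \<xi>|lborel. \<bar>h (\<xi> + ?\<eta> x) - h \<xi>\<bar>)"
        unfolding eventually_at_infinity
        by (intro exI[of _ 1] allI impI) (metis norm_zero not_one_le_zero)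
    qed
  qed
  with cont show ?thesis by (simp add: C0_def)
qed

section \<open>Tempered functions and their mollifications\<close>

lemma tempered_measurable: "tempered f \<Longrightarrow> f \<in> borel_measurable borel"
  by (simp add: tempered_def)

lemma gaussian_schwartz:
  fixes u :: "'a::euclidean_space"
  assumes "a > 0"
  shows "schwartz (\<lambda>x. complex_of_real (exp (- a * (x \<bullet> x))) * iexp (u \<bullet> x))"
  by (rule gaussian_class_schwartz[OF assms gaussian_class.base])

lemma tempered_gaussian_integrable:
  fixes f :: "'a::euclidean_space \<Rightarrow> ennreal"
  assumes "tempered f" and "a > 0"
  shows "(\<integral>\<^sup>+x. f x * ennreal (exp (- a * (x \<bullet> x))) \<partial>lborel) < \<infinity>"
proof -
  have "(\<integral>\<^sup>+x. f x * ennreal (norm (complex_of_real (exp (- a * (x \<bullet> x))) * iexp (0 \<bullet> x))) \<partial>lborel) < \<infinity>"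
    using assms(1) gaussian_schwartz[OF assms(2)] unfolding tempered_def by blast
  then show ?thesis by (simp add: norm_mult)
qed

lemma tempered_AE_finite:
  fixes f :: "'a::euclidean_space \<Rightarrow> ennreal"
  assumes "tempered f"
  shows "AE x in lborel. f x < \<infinity>"
proof -
  note [measurable] = tempered_measurable[OF assms]
  have "AE x in lborel. f x * ennreal (exp (- 1 * (x \<bullet> x))) \<noteq> \<infinity>"
    using tempered_gaussian_integrable[OF assms, of 1]
    by (intro nn_integral_PInf_AE) auto
  then show ?thesis
    by eventually_elim (auto simp: ennreal_mult_eq_top_iff less_top)
qed

text \<open>In exponents this inequality compares a Gaussian with its translates: shifting by \<open>y\<close> costs a
  factor depending on \<open>y\<close> and half of the decay rate.\<close>

lemma inner_self_le_sum:
  fixes x y :: "'a::real_inner"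
  shows "x \<bullet> x \<le> 2 * ((x + y) \<bullet> (x + y)) + 2 * (y \<bullet> y)"
proof -
  have "0 \<le> (x + 2 *\<^sub>R y) \<bullet> (x + 2 *\<^sub>R y)" by simp
  then show ?thesis by (simp add: inner_add_left inner_add_right inner_commute algebra_simps)
qed

text \<open>The convolution of \<open>f\<close> with the Gaussian density \<open>gauss s\<close>.\<close>

definition mollify :: "real \<Rightarrow> ('a::euclidean_space \<Rightarrow> ennreal) \<Rightarrow> 'a \<Rightarrow> ennreal" where
  "mollify s f u = (\<integral>\<^sup>+y. f y * ennreal (gauss s (y - u)) \<partial>lborel)"

lemma borel_measurable_mollify [measurable]:
  assumes [measurable]: "f \<in> borel_measurable borel"
  shows "mollify s f \<in> borel_measurable borel"
  unfolding mollify_def[abs_def] by measurable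

lemma mollify_finite:
  fixes f :: "'a::euclidean_space \<Rightarrow> ennreal"
  assumes f: "tempered f" and s: "s > 0"
  shows "mollify s f u < \<infinity>"
proof -
  note [measurable] = tempered_measurable[OF f]
  define a where "a = 1 / (2 * s\<^sup>2)"
  have a: "a > 0" using s by (simp add: a_def)
  define K where "K = exp (a * (u \<bullet> u)) / sqrt (2 * pi * s\<^sup>2) ^ DIM('a)"
  have K: "K \<ge> 0" unfolding K_def by simp
  have "gauss s (y - u) \<le> K * exp (- (a / 2) * (y \<bullet> y))" for y
  proof -
    have "y \<bullet> y \<le> 2 * ((y - u) \<bullet> (y - u)) + 2 * (u \<bullet> u)"
      using inner_self_le_sum[of y "- u"] by simp
    then have "a / 2 * (y \<bullet> y) \<le> a / 2 * (2 * ((y - u) \<bullet> (y - u)) + 2 * (u \<bullet> u))"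
      using a by (intro mult_left_mono) auto
    then have "- ((y - u) \<bullet> (y - u)) * a \<le> a * (u \<bullet> u) + - (a / 2) * (y \<bullet> y)"
      by (simp add: algebra_simps)
    then have "exp (- ((y - u) \<bullet> (y - u)) * a) \<le> exp (a * (u \<bullet> u)) * exp (- (a / 2) * (y \<bullet> y))"
      by (simp only: exp_add[symmetric] exp_le_cancel_iff)
    then show ?thesis
      using s by (simp add: gauss_eq_exp K_def a_def divide_right_mono)
  qed
  then have "ennreal (gauss s (y - u)) \<le> ennreal K * ennreal (exp (- (a / 2) * (y \<bullet> y)))" for y
    using K by (simp only: ennreal_mult'[symmetric] ennreal_leI)
  then have "f y * ennreal (gauss s (y - u)) \<le> ennreal K * (f y * ennreal (exp (- (a / 2) * (y \<bullet> y))))" for y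
    using mult_left_mono[of _ _ "f y"] by (simp only: mult.left_commute[of "ennreal K"] zero_le)
  then have "mollify s f u \<le> (\<integral>\<^sup>+y. ennreal K * (f y * ennreal (exp (- (a / 2) * (y \<bullet> y)))) \<partial>lborel)"
    unfolding mollify_def by (intro nn_integral_mono)
  also have "\<dots> = ennreal K * (\<integral>\<^sup>+y. f y * ennreal (exp (- (a / 2) * (y \<bullet> y))) \<partial>lborel)"
    by (rule nn_integral_cmult) measurable
  also have "\<dots> < \<infinity>"
    using tempered_gaussian_integrable[OF f, of "a / 2"] a by (auto simp: ennreal_mult_less_top)
  finally show ?thesis .
qed

lemma lebesgue_integral_enn2real:
  assumes [measurable]: "f \<in> borel_measurable M" "g \<in> borel_measurable M"
    and fin: "AE x in M. f x < \<infinity>" and g: "\<And>x. 0 \<le> g x"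
  shows "(\<integral>\<^sup>+x. f x * ennreal (g x) \<partial>M) = (\<integral>\<^sup>+x. ennreal (enn2real (f x) * g x) \<partial>M)"
    and "(LINT x|M. enn2real (f x) * g x) = enn2real (\<integral>\<^sup>+x. f x * ennreal (g x) \<partial>M)"
    and "(\<integral>\<^sup>+x. f x * ennreal (g x) \<partial>M) < \<infinity> \<Longrightarrow> integrable M (\<lambda>x. enn2real (f x) * g x)"
proof -
  show *: "(\<integral>\<^sup>+x. f x * ennreal (g x) \<partial>M) = (\<integral>\<^sup>+x. ennreal (enn2real (f x) * g x) \<partial>M)"
    using fin by (intro nn_integral_cong_AE) (auto simp: ennreal_mult g ennreal_enn2real_if elim!: eventually_mono)
  show "(LINT x|M. enn2real (f x) * g x) = enn2real (\<integral>\<^sup>+x. f x * ennreal (g x) \<partial>M)"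
    unfolding * by (rule integral_eq_nn_integral) (auto simp: g)
  show "integrable M (\<lambda>x. enn2real (f x) * g x)" if "(\<integral>\<^sup>+x. f x * ennreal (g x) \<partial>M) < \<infinity>"
    using that unfolding * by (intro integrableI_nonneg) (auto simp: g)
qed

text \<open>The defining duality of the distributional Fourier transform, tested on a modulated Gaussian, is a
  pointwise Fourier inversion formula for the mollified function.\<close>

lemma mollify_fourier:
  fixes f fhat :: "'a::euclidean_space \<Rightarrow> ennreal"
  assumes ft: "has_fourier_transform f fhat" and s: "s > 0"
  shows "complex_of_real (enn2real (mollify s f u)) = of_real (1 / (2 * pi) ^ DIM('a)) *
     (LINT \<xi>|lborel. of_real (enn2real (fhat \<xi>) * exp (- (s\<^sup>2 / 2) * (\<xi> \<bullet> \<xi>))) * iexp (- (u \<bullet> \<xi>)))"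
proof -
  have temp: "tempered f" "tempered fhat" using ft by (auto simp: has_fourier_transform_def)
  note [measurable] = tempered_measurable[OF temp(1)] tempered_measurable[OF temp(2)]
  let ?\<phi> = "\<lambda>\<xi>. complex_of_real (exp (- (s\<^sup>2 / 2) * (\<xi> \<bullet> \<xi>))) * iexp ((- u) \<bullet> \<xi>)"
  have "schwartz ?\<phi>" using s by (intro gaussian_schwartz) simp
  then have "distr_pairing fhat ?\<phi> = distr_pairing f (fourier ?\<phi>)"
    using ft by (simp add: has_fourier_transform_def)
  also have "\<dots> = (LINT y|lborel. of_real ((2 * pi) ^ DIM('a) * (enn2real (f y) * gauss s (y - u))))"
    unfolding distr_pairing_def fourier_gaussian[OF s]
    by (intro Bochner_Integration.integral_cong refl) (simp add: mult_ac)
  also have "\<dots> = of_real ((2 * pi) ^ DIM('a) * enn2real (mollify s f u))"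
    unfolding integral_complex_of_real integral_mult_right_zero mollify_def
    by (subst lebesgue_integral_enn2real(2)) (auto simp: gauss_nonneg tempered_AE_finite[OF temp(1), unfolded infinity_ennreal_def])
  finally have "distr_pairing fhat ?\<phi> = of_real ((2 * pi) ^ DIM('a)) * of_real (enn2real (mollify s f u))"
    by simp
  then have "of_real (enn2real (mollify s f u)) = of_real (1 / (2 * pi) ^ DIM('a)) * distr_pairing fhat ?\<phi>"
    by simp
  also have "distr_pairing fhat ?\<phi> =
     (LINT \<xi>|lborel. of_real (enn2real (fhat \<xi>) * exp (- (s\<^sup>2 / 2) * (\<xi> \<bullet> \<xi>))) * iexp (- (u \<bullet> \<xi>)))"
    unfolding distr_pairing_def
    by (intro Bochner_Integration.integral_cong refl) (simp add: mult_ac)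
  finally show ?thesis .
qed

section \<open>The energy of a mollified kernel\<close>

lemma integrable_times_iexp:
  fixes b :: "'a::euclidean_space \<Rightarrow> complex"
  assumes "integrable lborel b"
  shows "integrable lborel (\<lambda>\<xi>. b \<xi> * iexp (c * (x \<bullet> \<xi>)))"
  by (rule Bochner_Integration.integrable_bound[OF assms])
    (use assms in \<open>auto simp: norm_mult\<close>)

lemma fourier_exchange:
  fixes a b :: "'a::euclidean_space \<Rightarrow> complex"
  assumes a: "integrable lborel a" and b: "integrable lborel b"
  shows "(LINT x|lborel. a x * (LINT \<xi>|lborel. b \<xi> * iexp (c * (x \<bullet> \<xi>))))
       = (LINT \<xi>|lborel. b \<xi> * (LINT x|lborel. a x * iexp (c * (x \<bullet> \<xi>))))"
proof -
  have [measurable]: "a \<in> borel_measurable borel" "b \<in> borel_measurable borel" using a b by auto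
  have "integrable (lborel \<Otimes>\<^sub>M lborel) (\<lambda>(x, \<xi>). a x * b \<xi>)"
  proof (rule lborel_pair.Fubini_integrable)
    show "integrable lborel (\<lambda>x. LINT y|lborel. norm (case (x, y) of (x, \<xi>) \<Rightarrow> a x * b \<xi>))"
      using a by (simp add: norm_mult)
  qed (use b in auto)
  then have "integrable (lborel \<Otimes>\<^sub>M lborel) (\<lambda>(x, \<xi>). a x * b \<xi> * iexp (c * (x \<bullet> \<xi>)))"
    by (rule Bochner_Integration.integrable_bound) (auto simp: norm_mult)
  from lborel_pair.Fubini_integral[OF this]
  have "(LINT \<xi>|lborel. (LINT x|lborel. a x * b \<xi> * iexp (c * (x \<bullet> \<xi>))))
      = (LINT x|lborel. (LINT \<xi>|lborel. a x * b \<xi> * iexp (c * (x \<bullet> \<xi>))))" by simp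
  moreover have "(LINT \<xi>|lborel. a x * b \<xi> * iexp (c * (x \<bullet> \<xi>))) = a x * (LINT \<xi>|lborel. b \<xi> * iexp (c * (x \<bullet> \<xi>)))" for x
    by (simp only: mult.assoc integral_mult_right_zero)
  moreover have "(LINT x|lborel. a x * b \<xi> * iexp (c * (x \<bullet> \<xi>))) = b \<xi> * (LINT x|lborel. a x * iexp (c * (x \<bullet> \<xi>)))" for \<xi>
    by (simp only: mult.commute[of "a _" "b _"] mult.assoc integral_mult_right_zero)
  ultimately show ?thesis by simp
qed

text \<open>The mutual potential energy of the measure with density \<open>p\<close> with respect to the kernel \<open>f (x - y)\<close>.\<close>

definition energy :: "('a::euclidean_space \<Rightarrow> ennreal) \<Rightarrow> ('a \<Rightarrow> real) \<Rightarrow> ennreal" where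
  "energy f p = (\<integral>\<^sup>+x. (\<integral>\<^sup>+y. ennreal (p x * p y) * f (x - y) \<partial>lborel) \<partial>lborel)"

lemma norm_fourier_le:
  fixes p :: "'a::euclidean_space \<Rightarrow> real"
  assumes p0: "\<And>x. 0 \<le> p x"
  shows "norm (fourier (\<lambda>x. of_real (p x)) \<xi>) \<le> (LINT x|lborel. p x)"
  unfolding fourier_def
  by (rule order_trans[OF integral_norm_bound]) (simp add: norm_mult p0)

lemma borel_measurable_fourier [measurable]:
  fixes g :: "'a::euclidean_space \<Rightarrow> complex"
  assumes [measurable]: "g \<in> borel_measurable borel"
  shows "fourier g \<in> borel_measurable borel"
  unfolding fourier_def[abs_def] by measurable

text \<open>For the mollified kernel the damped spectral measure \<open>fhat \<xi> * exp (- s\<^sup>2 |\<xi>|\<^sup>2 / 2)\<close> is finite, so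
  the inversion formula can be integrated against \<open>p x * p y\<close> and the order of integration
  exchanged; the two integrals over \<open>x\<close> and \<open>y\<close> become the Fourier transform of \<open>p\<close> and its
  conjugate.\<close>

lemma energy_mollify:
  fixes f fhat :: "'a::euclidean_space \<Rightarrow> ennreal" and p :: "'a \<Rightarrow> real"
  assumes ft: "has_fourier_transform f fhat" and s: "s > 0"
    and p: "integrable lborel p" and p0: "\<And>x. 0 \<le> p x"
  shows "energy (mollify s f) p = ennreal (1 / (2 * pi) ^ DIM('a)) *
    (\<integral>\<^sup>+\<xi>. fhat \<xi> * ennreal (exp (- (s\<^sup>2 / 2) * (\<xi> \<bullet> \<xi>)) * (cmod (fourier (\<lambda>x. of_real (p x)) \<xi>))\<^sup>2) \<partial>lborel)"
proof -
  have temp: "tempered f" "tempered fhat" using ft by (auto simp: has_fourier_transform_def)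
  note [measurable] = tempered_measurable[OF temp(1)] tempered_measurable[OF temp(2)]
  have [measurable]: "p \<in> borel_measurable borel" using p by auto
  define c where "c = 1 / (2 * pi) ^ DIM('a)"
  have c: "c > 0" by (simp add: c_def)
  define W where "W \<xi> = enn2real (fhat \<xi>) * exp (- (s\<^sup>2 / 2) * (\<xi> \<bullet> \<xi>))" for \<xi>
  have [measurable]: "W \<in> borel_measurable borel" unfolding W_def[abs_def] by measurable
  have W0: "W \<xi> \<ge> 0" for \<xi> by (simp add: W_def)
  have W: "integrable lborel W"
    unfolding W_def[abs_def] using tempered_AE_finite[OF temp(2)] tempered_gaussian_integrable[OF temp(2), of "s\<^sup>2 / 2"] s
    by (intro lebesgue_integral_enn2real(3)) auto
  define g where "g u = enn2real (mollify s f u)" for u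
  have [measurable]: "g \<in> borel_measurable borel" unfolding g_def[abs_def] by measurable
  have g0: "g u \<ge> 0" for u by (simp add: g_def)
  have gf: "mollify s f u = ennreal (g u)" for u
    using mollify_finite[OF temp(1) s, of u] by (simp add: g_def)
  have gW: "complex_of_real (g u) = of_real c * (LINT \<xi>|lborel. of_real (W \<xi>) * iexp (- (u \<bullet> \<xi>)))" for u
    unfolding g_def W_def c_def by (rule mollify_fourier[OF ft s])
  define G where "G = c * (LINT \<xi>|lborel. W \<xi>)"
  have gG: "g u \<le> G" for u
  proof -
    have "g u = norm (complex_of_real (g u))" using g0[of u] by simp
    also have "\<dots> \<le> c * (LINT \<xi>|lborel. norm (complex_of_real (W \<xi>) * iexp (- (u \<bullet> \<xi>))))"
      unfolding gW using c by (simp add: norm_mult del: exp_minus) (intro integral_norm_bound[THEN order_trans], simp add: norm_mult)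
    also have "\<dots> = G" by (simp add: G_def norm_mult W0)
    finally show ?thesis .
  qed
  let ?P = "\<lambda>\<xi>. fourier (\<lambda>x. complex_of_real (p x)) \<xi>"
  have cp: "integrable lborel (\<lambda>x. complex_of_real (p x))" using p by simp
  have int1: "integrable lborel (\<lambda>y. p y * g (x - y))" for x
  proof (rule Bochner_Integration.integrable_bound[OF integrable_mult_left[OF p, of G]])
    show "AE y in lborel. norm (p y * g (x - y)) \<le> norm (p y * G)"
      using gG g0 p0 order_trans[OF g0 gG] by (intro AE_I2) (simp add: abs_mult mult_left_mono)
  qed measurable
  define k where "k x = (LINT y|lborel. p y * g (x - y))" for x
  have k0: "k x \<ge> 0" for x unfolding k_def by (intro Bochner_Integration.integral_nonneg) (simp add: p0 g0)
  have kb: "k x \<le> (LINT y|lborel. p y * G)" for x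
    unfolding k_def by (intro integral_mono int1 integrable_mult_left p mult_left_mono gG p0)
  have [measurable]: "k \<in> borel_measurable borel" unfolding k_def[abs_def] by measurable
  have int2: "integrable lborel (\<lambda>x. p x * k x)"
  proof (rule Bochner_Integration.integrable_bound[OF integrable_mult_left[OF p, of "LINT y|lborel. p y * G"]])
    show "AE x in lborel. norm (p x * k x) \<le> norm (p x * (LINT y|lborel. p y * G))"
      using kb k0 p0 order_trans[OF g0 gG] by (intro AE_I2) (simp add: abs_mult mult_left_mono)
  qed measurable
  have inner: "(\<integral>\<^sup>+y. ennreal (p x * p y) * mollify s f (x - y) \<partial>lborel) = ennreal (p x * k x)" for x
  proof -
    have "(\<integral>\<^sup>+y. ennreal (p x * p y) * mollify s f (x - y) \<partial>lborel) = (\<integral>\<^sup>+y. ennreal (p x * (p y * g (x - y))) \<partial>lborel)"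
      by (simp add: gf ennreal_mult[symmetric] p0 g0 mult.assoc)
    also have "\<dots> = ennreal (LINT y|lborel. p x * (p y * g (x - y)))"
      by (intro nn_integral_eq_integral integrable_mult_right int1) (simp add: p0 g0)
    finally show ?thesis by (simp add: k_def)
  qed
  have "energy (mollify s f) p = ennreal (LINT x|lborel. p x * k x)"
    unfolding energy_def inner by (intro nn_integral_eq_integral int2) (simp add: p0 k0)
  also have "(LINT x|lborel. p x * k x) = c * (LINT \<xi>|lborel. W \<xi> * (cmod (?P \<xi>))\<^sup>2)"
  proof -
    have intWP: "integrable lborel (\<lambda>\<xi>. complex_of_real (W \<xi>) * ?P \<xi>)"
    proof (rule Bochner_Integration.integrable_bound[OF integrable_mult_left[OF W, of "LINT x|lborel. p x"]])
      show "AE \<xi> in lborel. norm (complex_of_real (W \<xi>) * ?P \<xi>) \<le> norm (W \<xi> * (LINT x|lborel. p x))"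
        using norm_fourier_le[of p] p0 W0 by (intro AE_I2) (simp add: norm_mult mult_left_mono order_trans[OF norm_ge_zero])
    qed measurable
    have kk: "complex_of_real (k x) = of_real c * (LINT \<xi>|lborel. (of_real (W \<xi>) * ?P \<xi>) * iexp ((-1) * (x \<bullet> \<xi>)))" for x
    proof -
      have "complex_of_real (k x) = (LINT y|lborel. of_real (p y) * of_real (g (x - y)))"
        unfolding k_def integral_complex_of_real[symmetric] by simp
      also have "\<dots> = (LINT y|lborel. of_real c * (of_real (p y) *
          (LINT \<xi>|lborel. (of_real (W \<xi>) * iexp ((-1) * (x \<bullet> \<xi>))) * iexp (1 * (y \<bullet> \<xi>)))))"
      proof -
        have "iexp (- ((x - y) \<bullet> \<xi>)) = iexp ((-1) * (x \<bullet> \<xi>)) * iexp (1 * (y \<bullet> \<xi>))" for y \<xi>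
          unfolding exp_add[symmetric] by (simp add: inner_diff_left right_diff_distrib)
        then show ?thesis unfolding gW by (simp only: mult_ac)
      qed
      also have "\<dots> = of_real c * (LINT \<xi>|lborel. (of_real (W \<xi>) * iexp ((-1) * (x \<bullet> \<xi>))) *
          (LINT y|lborel. of_real (p y) * iexp (1 * (y \<bullet> \<xi>))))"
        unfolding integral_mult_right_zero
        by (subst fourier_exchange[OF cp integrable_times_iexp]) (use W in simp_all)
      also have "\<dots> = of_real c * (LINT \<xi>|lborel. (of_real (W \<xi>) * ?P \<xi>) * iexp ((-1) * (x \<bullet> \<xi>)))"
        by (simp add: fourier_def mult_ac)
      finally show ?thesis .
    qed
    have "complex_of_real (LINT x|lborel. p x * k x) = (LINT x|lborel. of_real (p x) * of_real (k x))"
      unfolding integral_complex_of_real[symmetric] by simp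
    also have "\<dots> = of_real c * (LINT x|lborel. of_real (p x) * (LINT \<xi>|lborel. (of_real (W \<xi>) * ?P \<xi>) * iexp ((-1) * (x \<bullet> \<xi>))))"
      unfolding kk by (simp only: mult.left_commute[of _ "of_real c"] integral_mult_right_zero)
    also have "\<dots> = of_real c * (LINT \<xi>|lborel. (of_real (W \<xi>) * ?P \<xi>) * (LINT x|lborel. of_real (p x) * iexp ((-1) * (x \<bullet> \<xi>))))"
      by (subst fourier_exchange[OF cp intWP]) simp
    also have "\<dots> = of_real c * (LINT \<xi>|lborel. of_real (W \<xi> * (cmod (?P \<xi>))\<^sup>2))"
    proof -
      have "(LINT x|lborel. complex_of_real (p x) * iexp ((-1) * (x \<bullet> \<xi>))) = cnj (?P \<xi>)" for \<xi>
        unfolding fourier_def Bochner_Integration.integral_cnj[symmetric] by (simp add: exp_cnj mult.commute)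
      then show ?thesis by (simp only: of_real_mult mult.assoc complex_norm_square)
    qed
    finally have "complex_of_real (LINT x|lborel. p x * k x) = of_real (c * (LINT \<xi>|lborel. W \<xi> * (cmod (?P \<xi>))\<^sup>2))"
      unfolding integral_complex_of_real by simp
    then show ?thesis by (simp only: of_real_eq_iff)
  qed
  also have "ennreal (c * (LINT \<xi>|lborel. W \<xi> * (cmod (?P \<xi>))\<^sup>2)) = ennreal c * (\<integral>\<^sup>+\<xi>. ennreal (W \<xi> * (cmod (?P \<xi>))\<^sup>2) \<partial>lborel)"
  proof -
    have "integrable lborel (\<lambda>\<xi>. W \<xi> * (cmod (?P \<xi>))\<^sup>2)"
    proof (rule Bochner_Integration.integrable_bound[OF integrable_mult_left[OF W, of "(LINT x|lborel. p x)\<^sup>2"]])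
      show "AE \<xi> in lborel. norm (W \<xi> * (cmod (?P \<xi>))\<^sup>2) \<le> norm (W \<xi> * (LINT x|lborel. p x)\<^sup>2)"
        using norm_fourier_le[of p] p0 W0 by (intro AE_I2) (simp add: abs_mult mult_left_mono power_mono)
    qed measurable
    then show ?thesis
      using c by (subst nn_integral_eq_integral) (auto simp: W0 ennreal_mult' Bochner_Integration.integral_nonneg)
  qed
  also have "(\<integral>\<^sup>+\<xi>. ennreal (W \<xi> * (cmod (?P \<xi>))\<^sup>2) \<partial>lborel) =
      (\<integral>\<^sup>+\<xi>. fhat \<xi> * ennreal (exp (- (s\<^sup>2 / 2) * (\<xi> \<bullet> \<xi>)) * (cmod (?P \<xi>))\<^sup>2) \<partial>lborel)"
    unfolding W_def mult.assoc
    by (rule lebesgue_integral_enn2real(1)[symmetric]) (use tempered_AE_finite[OF temp(2)] in auto)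
  finally show ?thesis unfolding c_def .
qed

section \<open>Parseval identity for the energy\<close>

text \<open>The energy is the integral of \<open>f\<close> against this function. Mollifying \<open>f\<close> amounts to mollifying the
  autocorrelation instead, which is far more regular than \<open>f\<close>.\<close>

definition autocorrelation :: "('a::euclidean_space \<Rightarrow> real) \<Rightarrow> 'a \<Rightarrow> ennreal" where
  "autocorrelation p w = (\<integral>\<^sup>+y. ennreal (p (y + w) * p y) \<partial>lborel)"

lemma borel_measurable_autocorrelation [measurable]:
  assumes [measurable]: "p \<in> borel_measurable borel"
  shows "autocorrelation p \<in> borel_measurable borel"
  unfolding autocorrelation_def[abs_def] by measurable

lemma energy_autocorrelation:
  fixes f :: "'a::euclidean_space \<Rightarrow> ennreal"
  assumes [measurable]: "f \<in> borel_measurable borel" "p \<in> borel_measurable borel"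
  shows "energy f p = (\<integral>\<^sup>+w. f w * autocorrelation p w \<partial>lborel)"
proof -
  have "energy f p = (\<integral>\<^sup>+y. (\<integral>\<^sup>+x. ennreal (p x * p y) * f (x - y) \<partial>lborel) \<partial>lborel)"
    unfolding energy_def by (rule lborel_pair.Fubini'[symmetric]) measurable
  also have "\<dots> = (\<integral>\<^sup>+y. (\<integral>\<^sup>+w. ennreal (p (w + y) * p y) * f w \<partial>lborel) \<partial>lborel)"
  proof (rule nn_integral_cong)
    fix y :: 'a
    show "(\<integral>\<^sup>+x. ennreal (p x * p y) * f (x - y) \<partial>lborel) = (\<integral>\<^sup>+w. ennreal (p (w + y) * p y) * f w \<partial>lborel)"
      by (subst nn_integral_lborel_translate[of "\<lambda>x. ennreal (p x * p y) * f (x - y)" y, symmetric]) simp_all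
  qed
  also have "\<dots> = (\<integral>\<^sup>+w. (\<integral>\<^sup>+y. ennreal (p (w + y) * p y) * f w \<partial>lborel) \<partial>lborel)"
    by (rule lborel_pair.Fubini') measurable
  also have "\<dots> = (\<integral>\<^sup>+w. f w * autocorrelation p w \<partial>lborel)"
    unfolding autocorrelation_def
    by (rule nn_integral_cong) (simp add: nn_integral_multc mult.commute[of "f _"] add.commute)
  finally show ?thesis .
qed

lemma nn_integral_gauss_affine:
  fixes g :: "'a::euclidean_space \<Rightarrow> ennreal"
  assumes [measurable]: "g \<in> borel_measurable borel" and s: "s > 0"
  shows "(\<integral>\<^sup>+w. g w * ennreal (gauss s (z - w)) \<partial>lborel) = (\<integral>\<^sup>+v. g (z + s *\<^sub>R v) * ennreal (gauss 1 v) \<partial>lborel)"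
proof -
  have "(\<integral>\<^sup>+w. g w * ennreal (gauss s (z - w)) \<partial>lborel)
      = (\<integral>\<^sup>+w. g w * ennreal (gauss s (z - w)) \<partial>density (distr lborel borel (\<lambda>x. z + s *\<^sub>R x)) (\<lambda>_. ennreal (\<bar>s\<bar> ^ DIM('a))))"
    using lborel_affine[of s z] s by simp
  also have "\<dots> = (\<integral>\<^sup>+v. ennreal (s ^ DIM('a)) * (g (z + s *\<^sub>R v) * ennreal (gauss s (- (s *\<^sub>R v)))) \<partial>lborel)"
    using s by (simp add: nn_integral_density nn_integral_distr)
  also have "\<dots> = (\<integral>\<^sup>+v. g (z + s *\<^sub>R v) * ennreal (gauss 1 v) \<partial>lborel)"
  proof (intro nn_integral_cong)
    fix v :: 'a
    have "ennreal (s ^ DIM('a)) * (g (z + s *\<^sub>R v) * ennreal (gauss s (- (s *\<^sub>R v))))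
        = g (z + s *\<^sub>R v) * ennreal (gauss s (s *\<^sub>R v) * s ^ DIM('a))"
      using s by (simp add: gauss_minus ennreal_mult gauss_nonneg mult_ac)
    then show "ennreal (s ^ DIM('a)) * (g (z + s *\<^sub>R v) * ennreal (gauss s (- (s *\<^sub>R v)))) = g (z + s *\<^sub>R v) * ennreal (gauss 1 v)"
      by (simp only: gauss_rescale[OF s])
  qed
  finally show ?thesis .
qed

text \<open>The mollified autocorrelation is written as an average over a fixed standard Gaussian displacement
  \<open>v\<close>, scaled by \<open>s\<close>, because in this form the limit \<open>s \<rightarrow> 0\<close> can be taken under the integral.\<close>

lemma energy_mollify_autocorrelation:
  fixes f :: "'a::euclidean_space \<Rightarrow> ennreal"
  assumes [measurable]: "f \<in> borel_measurable borel" "p \<in> borel_measurable borel" and s: "s > 0"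
  shows "energy (mollify s f) p = (\<integral>\<^sup>+z. f z * (\<integral>\<^sup>+v. autocorrelation p (z + s *\<^sub>R v) * ennreal (gauss 1 v) \<partial>lborel) \<partial>lborel)"
proof -
  have "energy (mollify s f) p = (\<integral>\<^sup>+w. mollify s f w * autocorrelation p w \<partial>lborel)"
    by (rule energy_autocorrelation) measurable
  also have "\<dots> = (\<integral>\<^sup>+w. (\<integral>\<^sup>+z. f z * ennreal (gauss s (z - w)) * autocorrelation p w \<partial>lborel) \<partial>lborel)"
    unfolding mollify_def by (simp add: nn_integral_multc)
  also have "\<dots> = (\<integral>\<^sup>+z. (\<integral>\<^sup>+w. f z * ennreal (gauss s (z - w)) * autocorrelation p w \<partial>lborel) \<partial>lborel)"
    by (rule lborel_pair.Fubini') measurable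
  also have "\<dots> = (\<integral>\<^sup>+z. f z * (\<integral>\<^sup>+w. autocorrelation p w * ennreal (gauss s (z - w)) \<partial>lborel) \<partial>lborel)"
    by (intro nn_integral_cong) (simp add: nn_integral_cmult[symmetric] mult_ac)
  finally show ?thesis by (simp only: nn_integral_gauss_affine[OF borel_measurable_autocorrelation[OF assms(2)] s])
qed

text \<open>The last claim, continuity, is where continuity of translations in \<open>L\<^sup>1\<close> enters: the difference of
  two values is at most \<open>B\<close> times the \<open>L\<^sup>1\<close> distance of two translates of \<open>p\<close>.\<close>

lemma autocorrelation_bounded_support:
  fixes p :: "'a::euclidean_space \<Rightarrow> real"
  assumes p: "integrable lborel p" and p0: "\<And>x. 0 \<le> p x" and pB: "\<And>x. p x \<le> B"
    and supp: "\<forall>x. norm x > R \<longrightarrow> p x = 0"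
  shows "autocorrelation p w \<le> ennreal (B * (LINT x|lborel. p x))"
    and "norm w > 2 * R \<Longrightarrow> autocorrelation p w = 0"
    and "X \<longlonglongrightarrow> w \<Longrightarrow> (\<lambda>n. autocorrelation p (X n)) \<longlonglongrightarrow> autocorrelation p w"
proof -
  have [measurable]: "p \<in> borel_measurable borel" using p by auto
  have int: "integrable lborel (\<lambda>y. p (y + w) * p y)" for w
  proof (rule Bochner_Integration.integrable_bound[OF integrable_mult_right[OF p, of B]])
    show "AE x in lborel. norm (p (x + w) * p x) \<le> norm (B * p x)"
      using p0 pB order_trans[OF p0 pB] by (intro AE_I2) (simp add: abs_mult mult_right_mono)
  qed measurable
  have eq: "autocorrelation p w = ennreal (LINT y|lborel. p (y + w) * p y)" for w
    unfolding autocorrelation_def by (intro nn_integral_eq_integral int) (simp add: p0)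
  have "(LINT y|lborel. p (y + w) * p y) \<le> (LINT y|lborel. B * p y)"
    by (intro integral_mono int integrable_mult_right p mult_right_mono pB p0)
  then show "autocorrelation p w \<le> ennreal (B * (LINT x|lborel. p x))"
    unfolding eq by (intro ennreal_leI) simp
  show "autocorrelation p w = 0" if "norm w > 2 * R"
  proof -
    have "p (y + w) * p y = 0" for y
    proof (cases "norm y > R")
      case False
      then have "norm (y + w) > R"
        using that norm_triangle_ineq4[of "y + w" y] by simp
      then show ?thesis using supp by simp
    qed (use supp in simp)
    then show ?thesis unfolding autocorrelation_def by (simp only: ennreal_0 nn_integral_const mult_zero_left)
  qed
  show "(\<lambda>n. autocorrelation p (X n)) \<longlonglongrightarrow> autocorrelation p w" if X: "X \<longlonglongrightarrow> w"
    unfolding eq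
  proof (rule tendsto_ennrealI, rule LIM_zero_cancel, rule Lim_null_comparison[OF always_eventually, rule_format])
    fix n
    have i: "integrable lborel (\<lambda>y. p (y + w))" for w by (rule lborel_translate(1)[OF p])
    have "norm ((LINT y|lborel. p (y + X n) * p y) - (LINT y|lborel. p (y + w) * p y))
       = norm (LINT y|lborel. p (y + X n) * p y - p (y + w) * p y)"
      by (simp add: Bochner_Integration.integral_diff int)
    also have "\<dots> \<le> (LINT y|lborel. B * \<bar>p (y + X n) - p (y + w)\<bar>)"
    proof (rule Bochner_Integration.integral_norm_bound_integral)
      show "norm (p (y + X n) * p y - p (y + w) * p y) \<le> B * \<bar>p (y + X n) - p (y + w)\<bar>" for y
        unfolding left_diff_distrib[symmetric] real_norm_def abs_mult mult.commute[of B]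
        using p0[of y] pB[of y] by (intro mult_left_mono) auto
    qed (intro Bochner_Integration.integrable_diff int integrable_mult_right integrable_abs i)+
    also have "\<dots> = B * (LINT y|lborel. \<bar>p (y + (X n - w)) - p y\<bar>)"
      using lborel_translate(2)[of "\<lambda>y. \<bar>p (y + (X n - w)) - p y\<bar>" w] by (simp add: algebra_simps)
    finally show "norm ((LINT y|lborel. p (y + X n) * p y) - (LINT y|lborel. p (y + w) * p y))
      \<le> B * (LINT y|lborel. \<bar>p (y + (X n - w)) - p y\<bar>)" .
  next
    have "(\<lambda>n. X n - w) \<longlonglongrightarrow> 0" using X by (rule LIM_zero)
    with L1_continuous_translation_integrable[OF p]
    have "(\<lambda>n. LINT y|lborel. \<bar>p (y + (X n - w)) - p y\<bar>) \<longlonglongrightarrow> 0"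
      unfolding L1_continuous_translation_def by (rule filterlim_compose)
    then show "(\<lambda>n. B * (LINT y|lborel. \<bar>p (y + (X n - w)) - p y\<bar>)) \<longlonglongrightarrow> 0"
      by (rule tendsto_mult_right_zero)
  qed
qed

definition spectral_energy :: "('a::euclidean_space \<Rightarrow> ennreal) \<Rightarrow> ('a \<Rightarrow> real) \<Rightarrow> ennreal" where
  "spectral_energy fhat p = ennreal (1 / (2 * pi) ^ DIM('a)) *
    (\<integral>\<^sup>+\<xi>. fhat \<xi> * ennreal ((cmod (fourier (\<lambda>x. of_real (p x)) \<xi>))\<^sup>2) \<partial>lborel)"

text \<open>On the Fourier side, mollification is a damping factor that increases to one.\<close>

lemma energy_mollify_tendsto_spectral:
  fixes f fhat :: "'a::euclidean_space \<Rightarrow> ennreal" and p :: "'a \<Rightarrow> real"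
  assumes ft: "has_fourier_transform f fhat"
    and p: "integrable lborel p" and p0: "\<And>x. 0 \<le> p x"
  shows "(\<lambda>n. energy (mollify (1 / real (Suc n)) f) p) \<longlonglongrightarrow> spectral_energy fhat p"
    and "energy (mollify (1 / real (Suc n)) f) p \<le> spectral_energy fhat p"
proof -
  have temp: "tempered f" "tempered fhat" using ft by (auto simp: has_fourier_transform_def)
  note [measurable] = tempered_measurable[OF temp(1)] tempered_measurable[OF temp(2)]
  have [measurable]: "p \<in> borel_measurable borel" using p by auto
  let ?P = "\<lambda>\<xi>. (cmod (fourier (\<lambda>x. of_real (p x)) \<xi>))\<^sup>2"
  let ?e = "\<lambda>n \<xi>::'a. exp (- ((1 / real (Suc n))\<^sup>2 / 2) * (\<xi> \<bullet> \<xi>))"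
  have eq: "energy (mollify (1 / real (Suc n)) f) p = ennreal (1 / (2 * pi) ^ DIM('a)) *
     (\<integral>\<^sup>+\<xi>. fhat \<xi> * ennreal (?e n \<xi> * ?P \<xi>) \<partial>lborel)" for n
    by (rule energy_mollify[OF ft _ p p0]) simp
  have "(\<lambda>n. \<integral>\<^sup>+\<xi>. fhat \<xi> * ennreal (?e n \<xi> * ?P \<xi>) \<partial>lborel) \<longlonglongrightarrow> (\<integral>\<^sup>+\<xi>. fhat \<xi> * ennreal (?P \<xi>) \<partial>lborel)"
  proof (rule nn_integral_LIMSEQ)
    have mono: "?e m \<xi> \<le> ?e n \<xi>" if "m \<le> n" for m n \<xi>
    proof -
      have "(1 / real (Suc n))\<^sup>2 / 2 \<le> (1 / real (Suc m))\<^sup>2 / 2"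
        using that by (intro divide_right_mono power_mono frac_le) auto
      then show ?thesis by (simp only: exp_le_cancel_iff mult_minus_left neg_le_iff_le mult_right_mono inner_ge_zero)
    qed
    show "incseq (\<lambda>n \<xi>. fhat \<xi> * ennreal (?e n \<xi> * ?P \<xi>))"
      by (intro monoI le_funI mult_left_mono ennreal_leI mult_right_mono mono) auto
    show "(\<lambda>n. fhat \<xi> * ennreal (?e n \<xi> * ?P \<xi>)) \<longlonglongrightarrow> fhat \<xi> * ennreal (?P \<xi>)" for \<xi>
    proof (cases "?P \<xi> = 0")
      case False
      have "(\<lambda>n. 1 / real (Suc n)) \<longlonglongrightarrow> 0"
        by (rule LIMSEQ_Suc[OF lim_1_over_n])
      then have "(\<lambda>n. ?e n \<xi> * ?P \<xi>) \<longlonglongrightarrow> exp (- (0\<^sup>2 / 2) * (\<xi> \<bullet> \<xi>)) * ?P \<xi>"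
        by (intro tendsto_intros) auto
      then have "(\<lambda>n. ennreal (?e n \<xi> * ?P \<xi>)) \<longlonglongrightarrow> ennreal (?P \<xi>)"
        by (intro tendsto_ennrealI) simp
      then show ?thesis
        using False by (intro tendsto_mult_ennreal tendsto_const) (auto simp: ennreal_eq_0_iff)
    qed simp
  qed measurable
  then show "(\<lambda>n. energy (mollify (1 / real (Suc n)) f) p) \<longlonglongrightarrow> spectral_energy fhat p"
    unfolding eq spectral_energy_def by (intro tendsto_mult_ennreal tendsto_const) auto
  have damp: "fhat \<xi> * ennreal (?e n \<xi> * ?P \<xi>) \<le> fhat \<xi> * ennreal (?P \<xi>)" for \<xi>
    by (intro mult_left_mono ennreal_leI mult_left_le_one_le) auto
  show "energy (mollify (1 / real (Suc n)) f) p \<le> spectral_energy fhat p"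
    unfolding eq spectral_energy_def by (rule mult_left_mono[OF nn_integral_mono[OF damp] zero_le])
qed

text \<open>For bounded \<open>p\<close> of bounded support the autocorrelation is continuous and lies below a multiple of
  \<open>exp (- |w|\<^sup>2 / 4)\<close>. Averaging over displacements of standard deviation at most one keeps it below a
  multiple of \<open>exp (- |z|\<^sup>2 / 8)\<close>, uniformly in the scale, and this bound is integrable against the
  tempered function \<open>f\<close>.\<close>

lemma energy_mollify_tendsto:
  fixes f :: "'a::euclidean_space \<Rightarrow> ennreal" and p :: "'a \<Rightarrow> real"
  assumes f: "tempered f"
    and p: "integrable lborel p" and p0: "\<And>x. 0 \<le> p x" and pB: "\<And>x. p x \<le> B"
    and supp: "\<forall>x. norm x > R \<longrightarrow> p x = 0"
  shows "(\<lambda>n. energy (mollify (1 / real (Suc n)) f) p) \<longlonglongrightarrow> energy f p"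
proof -
  note [measurable] = tempered_measurable[OF f]
  have [measurable]: "p \<in> borel_measurable borel" using p by auto
  note ac = autocorrelation_bounded_support[OF p p0 pB supp]
  define C where "C = B * (LINT x|lborel. p x)"
  have C: "C \<ge> 0" using order_trans[OF p0 pB] unfolding C_def
    by (intro mult_nonneg_nonneg Bochner_Integration.integral_nonneg p0) blast
  let ?s = "\<lambda>n. 1 / real (Suc n)"
  have s0: "?s \<longlonglongrightarrow> 0" by (rule LIMSEQ_Suc[OF lim_1_over_n])
  let ?A = "\<lambda>n z. \<integral>\<^sup>+v. autocorrelation p (z + ?s n *\<^sub>R v) * ennreal (gauss 1 v) \<partial>lborel"
  have eq: "energy (mollify (?s n) f) p = (\<integral>\<^sup>+z. f z * ?A n z \<partial>lborel)" for n
    by (rule energy_mollify_autocorrelation) auto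
  have A_lim: "(\<lambda>n. ?A n z) \<longlonglongrightarrow> autocorrelation p z" for z
  proof -
    have "(\<lambda>n. ?A n z) \<longlonglongrightarrow> (\<integral>\<^sup>+(v::'a). autocorrelation p z * ennreal (gauss 1 v) \<partial>lborel)"
    proof (rule nn_integral_dominated_convergence[where w="\<lambda>v::'a. ennreal C * ennreal (gauss 1 v)"])
      show "AE v in lborel. autocorrelation p (z + ?s n *\<^sub>R v) * ennreal (gauss 1 v) \<le> ennreal C * ennreal (gauss 1 v)" for n
        using ac(1) by (intro AE_I2 mult_right_mono) (auto simp: C_def)
      show "(\<integral>\<^sup>+(v::'a). ennreal C * ennreal (gauss 1 v) \<partial>lborel) < \<infinity>"
        by (simp add: nn_integral_cmult nn_integral_gauss)
      show "AE v in lborel. (\<lambda>n. autocorrelation p (z + ?s n *\<^sub>R v) * ennreal (gauss 1 v)) \<longlonglongrightarrow> autocorrelation p z * ennreal (gauss 1 v)"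
      proof (intro AE_I2)
        fix v :: 'a
        have "(\<lambda>n. z + ?s n *\<^sub>R v) \<longlonglongrightarrow> z"
          using tendsto_add[OF tendsto_const tendsto_scaleR[OF s0 tendsto_const], of z v] by simp
        then have "(\<lambda>n. autocorrelation p (z + ?s n *\<^sub>R v)) \<longlonglongrightarrow> autocorrelation p z"
          by (rule ac(3))
        then show "(\<lambda>n. autocorrelation p (z + ?s n *\<^sub>R v) * ennreal (gauss 1 v)) \<longlonglongrightarrow> autocorrelation p z * ennreal (gauss 1 v)"
          unfolding mult.commute[of _ "ennreal (gauss 1 v)"] by (intro ennreal_tendsto_cmult) auto
      qed
    qed measurable
    then show ?thesis by (simp add: nn_integral_cmult nn_integral_gauss)
  qed
  \<comment> \<open>On the support of the autocorrelation |w| is at most 2 R, so exp (R^2) compensates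
    exp (- |w|^2 / 4) there.\<close>
  define C' where "C' = C * exp (R\<^sup>2)"
  have C': "C' \<ge> 0" using C by (simp add: C'_def)
  have ac_gauss: "autocorrelation p w \<le> ennreal (C' * exp (- (1/4) * (w \<bullet> w)))" for w
  proof (cases "norm w > 2 * R")
    case False
    then have "(norm w)\<^sup>2 \<le> (2 * R)\<^sup>2" by (intro power_mono) auto
    then have "(1/4) * (w \<bullet> w) \<le> R\<^sup>2" by (simp add: power2_norm_eq_inner)
    then have "1 \<le> exp (R\<^sup>2) * exp (- (1/4) * (w \<bullet> w))" by (simp add: exp_add[symmetric])
    then have "C \<le> C' * exp (- (1/4) * (w \<bullet> w))"
      unfolding C'_def mult.assoc using C mult_left_mono[of 1 _ C] by simp
    then show ?thesis using ac(1)[of w] by (auto simp: C_def[symmetric] intro: order_trans ennreal_leI)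
  qed (simp add: ac(2))
  \<comment> \<open>The growth factor exp (|v|^2 / 4) turns the standard Gaussian into one of variance 2, up to the
    factor K.\<close>
  define K where "K = sqrt 2 ^ DIM('a)"
  have K: "K \<ge> 0" by (simp add: K_def)
  have gauss2: "exp (1/4 * (v \<bullet> v)) * gauss 1 v = K * gauss (sqrt 2) v" for v :: 'a
  proof -
    have "sqrt (2 * pi * 2) = sqrt 2 * sqrt (2 * pi)" by (simp add: real_sqrt_mult)
    then have "K * gauss (sqrt 2) v = exp (- (v \<bullet> v) / 4) / sqrt (2 * pi) ^ DIM('a)"
      by (simp add: gauss_eq_exp K_def power_mult_distrib)
    also have "\<dots> = exp (1/4 * (v \<bullet> v)) * gauss 1 v"
      by (simp add: gauss_eq_exp exp_add[symmetric])
    finally show ?thesis by simp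
  qed
  have A_dom: "?A n z \<le> ennreal (C' * K) * ennreal (exp (- (1/8) * (z \<bullet> z)))" for n z
  proof -
    have "?A n z \<le> (\<integral>\<^sup>+(v::'a). ennreal (C' * K * exp (- (1/8) * (z \<bullet> z))) * ennreal (gauss (sqrt 2) v) \<partial>lborel)"
    proof (intro nn_integral_mono)
      fix v :: 'a
      let ?w = "z + ?s n *\<^sub>R v"
      have "(?s n)\<^sup>2 \<le> 1" by (intro power_le_one) auto
      then have "(?s n *\<^sub>R v) \<bullet> (?s n *\<^sub>R v) \<le> v \<bullet> v"
        using mult_right_mono[of "(?s n)\<^sup>2" 1 "v \<bullet> v"] by (simp add: power2_eq_square)
      then have "z \<bullet> z \<le> 2 * (?w \<bullet> ?w) + 2 * (v \<bullet> v)"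
        using inner_self_le_sum[of z "?s n *\<^sub>R v"] by linarith
      then have "exp (- (1/4) * (?w \<bullet> ?w)) \<le> exp (- (1/8) * (z \<bullet> z)) * exp (1/4 * (v \<bullet> v))"
        unfolding exp_add[symmetric] exp_le_cancel_iff by linarith
      then have "C' * exp (- (1/4) * (?w \<bullet> ?w)) * gauss 1 v \<le> C' * (exp (- (1/8) * (z \<bullet> z)) * exp (1/4 * (v \<bullet> v))) * gauss 1 v"
        using C' by (intro mult_right_mono mult_left_mono gauss_nonneg)
      also have "\<dots> = C' * exp (- (1/8) * (z \<bullet> z)) * (exp (1/4 * (v \<bullet> v)) * gauss 1 v)" by (simp only: mult_ac)
      also have "\<dots> = C' * K * exp (- (1/8) * (z \<bullet> z)) * gauss (sqrt 2) v" unfolding gauss2 by (simp only: mult_ac)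
      finally have "ennreal (C' * exp (- (1/4) * (?w \<bullet> ?w)) * gauss 1 v) \<le> ennreal (C' * K * exp (- (1/8) * (z \<bullet> z)) * gauss (sqrt 2) v)"
        by (rule ennreal_leI)
      then have "ennreal (C' * exp (- (1/4) * (?w \<bullet> ?w))) * ennreal (gauss 1 v) \<le> ennreal (C' * K * exp (- (1/8) * (z \<bullet> z))) * ennreal (gauss (sqrt 2) v)"
        by (simp only: ennreal_mult''[OF gauss_nonneg])
      then show "autocorrelation p ?w * ennreal (gauss 1 v) \<le> ennreal (C' * K * exp (- (1/8) * (z \<bullet> z))) * ennreal (gauss (sqrt 2) v)"
        using mult_right_mono[OF ac_gauss[of ?w], of "ennreal (gauss 1 v)"] by (auto intro: order_trans)
    qed
    also have "\<dots> = ennreal (C' * K) * ennreal (exp (- (1/8) * (z \<bullet> z)))"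
      by (simp add: nn_integral_cmult nn_integral_gauss ennreal_mult'')
    finally show ?thesis .
  qed
  have "(\<lambda>n. \<integral>\<^sup>+z. f z * ?A n z \<partial>lborel) \<longlonglongrightarrow> (\<integral>\<^sup>+z. f z * autocorrelation p z \<partial>lborel)"
  proof (rule nn_integral_dominated_convergence[where w="\<lambda>z. ennreal (C' * K) * (f z * ennreal (exp (- (1/8) * (z \<bullet> z))))"])
    show "AE z in lborel. f z * ?A n z \<le> ennreal (C' * K) * (f z * ennreal (exp (- (1/8) * (z \<bullet> z))))" for n
      using mult_left_mono[OF A_dom, of "f _"] by (intro AE_I2) (simp only: mult.left_commute[of "f _"] zero_le)
    show "(\<integral>\<^sup>+z. ennreal (C' * K) * (f z * ennreal (exp (- (1/8) * (z \<bullet> z)))) \<partial>lborel) < \<infinity>"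
      using tempered_gaussian_integrable[OF f, of "1/8"]
      by (subst nn_integral_cmult) (auto simp: ennreal_mult_less_top)
    show "AE z in lborel. (\<lambda>n. f z * ?A n z) \<longlonglongrightarrow> f z * autocorrelation p z"
      using tempered_AE_finite[OF f]
    proof eventually_elim
      case (elim z)
      then show ?case by (intro ennreal_tendsto_cmult A_lim) auto
    qed
  qed measurable
  then show ?thesis
    unfolding eq by (subst energy_autocorrelation) auto
qed

lemma energy_mono:
  assumes "\<And>x. 0 \<le> p x" "\<And>x. p x \<le> q x"
  shows "energy f p \<le> energy f q"
  unfolding energy_def using assms order_trans[OF assms(1) assms(2)]
  by (intro nn_integral_mono mult_right_mono ennreal_leI mult_mono) auto

text \<open>Parseval's identity for the energy, an equality in \<open>[0, \<infinity>]\<close>. For truncations \<open>q n\<close> of \<open>p\<close> both sides are the limit of the energies of the mollified kernels. The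
  energy of \<open>q n\<close> increases to that of \<open>p\<close>. The upper bound for the energy of \<open>p\<close> holds because the
  mollified energies are monotone in the density and, for \<open>p\<close> itself, at most the spectral energy;
  the lower bound is Fatou's lemma on the Fourier
  side, where the transforms of the \<open>q n\<close> converge pointwise but need not be monotone.\<close>

theorem energy_eq_spectral_energy:
  fixes f fhat :: "'a::euclidean_space \<Rightarrow> ennreal" and p :: "'a \<Rightarrow> real"
  assumes ft: "has_fourier_transform f fhat"
    and p: "integrable lborel p" and p0: "\<And>x. 0 \<le> p x"
  shows "energy f p = spectral_energy fhat p"
proof -
  have temp: "tempered f" "tempered fhat" using ft by (auto simp: has_fourier_transform_def)
  note [measurable] = tempered_measurable[OF temp(1)] tempered_measurable[OF temp(2)]
  have [measurable]: "p \<in> borel_measurable borel" using p by auto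
  define q where "q n x = min (p x) (real n) * indicator (cball 0 (real n)) x" for n and x :: 'a
  have q0: "0 \<le> q n x" and qp: "q n x \<le> p x" and qB: "q n x \<le> real n" for n x
    using p0[of x] by (auto simp: q_def indicator_def)
  have supp: "\<forall>x. norm x > real n \<longrightarrow> q n x = 0" for n by (simp add: q_def)
  have [measurable]: "cball (0::'a) r \<in> sets borel" for r by (rule borel_closed) simp
  have [measurable]: "q n \<in> borel_measurable borel" for n unfolding q_def[abs_def] by measurable
  have q: "integrable lborel (q n)" for n
    by (rule Bochner_Integration.integrable_bound[OF p]) (use q0 qp p0 in auto)
  have qlim: "(\<lambda>n. q n x) \<longlonglongrightarrow> p x" for x
  proof (rule tendsto_eventually)
    show "\<forall>\<^sub>F n in sequentially. q n x = p x"
      using eventually_ge_at_top[of "nat \<lceil>max (p x) (norm x)\<rceil>"]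
    proof eventually_elim
      case (elim n)
      then have "p x \<le> real n" "norm x \<le> real n" by linarith+
      then show ?case by (auto simp: q_def)
    qed
  qed
  have qmono: "q m x \<le> q n x" if "m \<le> n" for m n x
    using that p0[of x] by (auto simp: q_def indicator_def)
  have trunc: "energy f (q n) = spectral_energy fhat (q n)" for n
    using energy_mollify_tendsto[OF temp(1) q q0 qB supp] energy_mollify_tendsto_spectral(1)[OF ft q q0]
    by (rule LIMSEQ_unique)
  have le: "energy f (q n) \<le> spectral_energy fhat p" for n
  proof (rule LIMSEQ_le_const2[OF energy_mollify_tendsto[OF temp(1) q q0 qB supp]])
    show "\<exists>N. \<forall>k\<ge>N. energy (mollify (1 / real (Suc k)) f) (q n) \<le> spectral_energy fhat p"
      using energy_mono[OF q0 qp] energy_mollify_tendsto_spectral(2)[OF ft p p0]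
      by (intro exI[of _ 0] allI impI) (rule order_trans)
  qed
  have lim: "(\<lambda>n. energy f (q n)) \<longlonglongrightarrow> energy f p"
    unfolding energy_def
  proof (rule nn_integral_LIMSEQ)
    show "incseq (\<lambda>n x. \<integral>\<^sup>+y. ennreal (q n x * q n y) * f (x - y) \<partial>lborel)"
      by (intro monoI le_funI nn_integral_mono mult_right_mono ennreal_leI mult_mono qmono q0) auto
    fix x
    show "(\<lambda>n. \<integral>\<^sup>+y. ennreal (q n x * q n y) * f (x - y) \<partial>lborel) \<longlonglongrightarrow> (\<integral>\<^sup>+y. ennreal (p x * p y) * f (x - y) \<partial>lborel)"
    proof (rule nn_integral_LIMSEQ)
      show "incseq (\<lambda>n y. ennreal (q n x * q n y) * f (x - y))"
        by (intro monoI le_funI mult_right_mono ennreal_leI mult_mono qmono q0) auto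
      show "(\<lambda>n. ennreal (q n x * q n y) * f (x - y)) \<longlonglongrightarrow> ennreal (p x * p y) * f (x - y)" for y
      proof (cases "p x * p y = 0")
        case True
        then have "q n x * q n y = 0" for n
          using q0[of n x] q0[of n y] qp[of n x] qp[of n y] by auto
        with True show ?thesis by (simp only: tendsto_const)
      next
        case False
        then have "p x * p y > 0" using p0 by (simp add: less_le)
        then show ?thesis
          by (intro tendsto_mult_ennreal tendsto_const tendsto_ennrealI tendsto_mult qlim) (auto simp: ennreal_eq_0_iff)
      qed
    qed measurable
  qed measurable
  have "energy f p \<le> spectral_energy fhat p"
    by (rule LIMSEQ_le_const2[OF lim]) (use le in auto)
  moreover have "spectral_energy fhat p \<le> energy f p"
  proof -
    let ?P = "\<lambda>p \<xi>. (cmod (fourier (\<lambda>x. of_real (p x)) \<xi>))\<^sup>2"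
    have Plim: "(\<lambda>n. ?P (q n) \<xi>) \<longlonglongrightarrow> ?P p \<xi>" for \<xi>
    proof -
      have "(\<lambda>n. fourier (\<lambda>x. of_real (q n x)) \<xi>) \<longlonglongrightarrow> fourier (\<lambda>x. of_real (p x)) \<xi>"
        unfolding fourier_def
      proof (rule integral_dominated_convergence[where w=p])
        show "AE x in lborel. (\<lambda>n. iexp (x \<bullet> \<xi>) * complex_of_real (q n x)) \<longlonglongrightarrow> iexp (x \<bullet> \<xi>) * complex_of_real (p x)"
          by (intro AE_I2 tendsto_intros qlim)
        show "AE x in lborel. norm (iexp (x \<bullet> \<xi>) * complex_of_real (q n x)) \<le> p x" for n
          using q0 qp by (intro AE_I2) (simp add: norm_mult)
      qed (use p in auto)
      then show ?thesis by (intro tendsto_intros)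
    qed
    have "(\<integral>\<^sup>+\<xi>. fhat \<xi> * ennreal (?P p \<xi>) \<partial>lborel) = (\<integral>\<^sup>+\<xi>. liminf (\<lambda>n. fhat \<xi> * ennreal (?P (q n) \<xi>)) \<partial>lborel)"
    proof (rule nn_integral_cong_AE)
      show "AE \<xi> in lborel. fhat \<xi> * ennreal (?P p \<xi>) = liminf (\<lambda>n. fhat \<xi> * ennreal (?P (q n) \<xi>))"
        using tempered_AE_finite[OF temp(2)]
      proof eventually_elim
        case (elim \<xi>)
        then have "(\<lambda>n. fhat \<xi> * ennreal (?P (q n) \<xi>)) \<longlonglongrightarrow> fhat \<xi> * ennreal (?P p \<xi>)"
          by (intro ennreal_tendsto_cmult tendsto_ennrealI Plim) auto
        then show ?case by (intro lim_imp_Liminf[symmetric]) auto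
      qed
    qed
    also have "\<dots> \<le> liminf (\<lambda>n. \<integral>\<^sup>+\<xi>. fhat \<xi> * ennreal (?P (q n) \<xi>) \<partial>lborel)"
      by (rule nn_integral_liminf) measurable
    finally have fatou: "(\<integral>\<^sup>+\<xi>. fhat \<xi> * ennreal (?P p \<xi>) \<partial>lborel) \<le> liminf (\<lambda>n. \<integral>\<^sup>+\<xi>. fhat \<xi> * ennreal (?P (q n) \<xi>) \<partial>lborel)" .
    let ?c = "1 / (2 * pi) ^ DIM('a)"
    have I: "(\<integral>\<^sup>+\<xi>. fhat \<xi> * ennreal (?P (q n) \<xi>) \<partial>lborel) \<le> ennreal (1 / ?c) * energy f p" for n
    proof -
      have "ennreal (1 / ?c) * energy f p \<ge> ennreal (1 / ?c) * spectral_energy fhat (q n)"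
        unfolding trunc[symmetric] by (intro mult_left_mono energy_mono q0 qp) auto
      also have "ennreal (1 / ?c) * spectral_energy fhat (q n) = (\<integral>\<^sup>+\<xi>. fhat \<xi> * ennreal (?P (q n) \<xi>) \<partial>lborel)"
        unfolding spectral_energy_def mult.assoc[symmetric] by (simp add: ennreal_mult[symmetric])
      finally show ?thesis .
    qed
    have "liminf (\<lambda>n. \<integral>\<^sup>+\<xi>. fhat \<xi> * ennreal (?P (q n) \<xi>) \<partial>lborel) \<le> ennreal (1 / ?c) * energy f p"
      by (rule Liminf_le) (use I in auto)
    with fatou have "spectral_energy fhat p \<le> ennreal ?c * (ennreal (1 / ?c) * energy f p)"
      unfolding spectral_energy_def by (intro mult_left_mono) auto
    also have "\<dots> = energy f p"
      unfolding mult.assoc[symmetric] by (simp add: ennreal_mult[symmetric])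
    finally show ?thesis .
  qed
  ultimately show ?thesis by (rule antisym)
qed

section \<open>Polarisation\<close>

text \<open>The energy with the kernel recentred at \<open>x\<close>. If \<open>p\<close> is the density of \<open>X t\<close>, it is the value at
  \<open>x\<close> of the replica semigroup applied to \<open>f\<close>.\<close>

definition shifted_energy :: "('a::euclidean_space \<Rightarrow> ennreal) \<Rightarrow> ('a \<Rightarrow> real) \<Rightarrow> 'a \<Rightarrow> ennreal" where
  "shifted_energy f p x = (\<integral>\<^sup>+y. (\<integral>\<^sup>+z. ennreal (p y * p z) * f (x + y - z) \<partial>lborel) \<partial>lborel)"

text \<open>Polarisation: expanding the square produces the two diagonal terms at the origin and two cross terms,
  which agree because \<open>f\<close> is symmetric.\<close>

lemma energy_add_translate:
  fixes f :: "'a::euclidean_space \<Rightarrow> ennreal"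
  assumes [measurable]: "f \<in> borel_measurable borel" "p \<in> borel_measurable borel"
    and sym: "\<And>x. f (- x) = f x" and p0: "\<And>x. 0 \<le> p x"
  shows "energy f (\<lambda>y. p y + p (y - x)) = 2 * (shifted_energy f p 0 + shifted_energy f p x)"
proof -
  define I where "I g h = (\<integral>\<^sup>+y. (\<integral>\<^sup>+z. ennreal (g y * h z) * f (y - z) \<partial>lborel) \<partial>lborel)"
    for g h :: "'a \<Rightarrow> real"
  define q where "q y = p (y - x)" for y
  have [measurable]: "q \<in> borel_measurable borel" unfolding q_def[abs_def] by measurable
  have q0: "0 \<le> q y" for y by (simp add: q_def p0)
  have add_left: "I (\<lambda>y. g y + g' y) h = I g h + I g' h"
    if [measurable]: "g \<in> borel_measurable borel" "g' \<in> borel_measurable borel" "h \<in> borel_measurable borel"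
      and "\<And>y. 0 \<le> g y" "\<And>y. 0 \<le> g' y" "\<And>y. 0 \<le> h y" for g g' h
  proof -
    have "I (\<lambda>y. g y + g' y) h = (\<integral>\<^sup>+y. (\<integral>\<^sup>+z. ennreal (g y * h z) * f (y - z) + ennreal (g' y * h z) * f (y - z) \<partial>lborel) \<partial>lborel)"
      unfolding I_def
      by (simp only: distrib_right ennreal_plus that mult_nonneg_nonneg)
    also have "\<dots> = (\<integral>\<^sup>+y. (\<integral>\<^sup>+z. ennreal (g y * h z) * f (y - z) \<partial>lborel) + (\<integral>\<^sup>+z. ennreal (g' y * h z) * f (y - z) \<partial>lborel) \<partial>lborel)"
      by (intro nn_integral_cong nn_integral_add) measurable
    also have "\<dots> = I g h + I g' h"
      unfolding I_def by (rule nn_integral_add) measurable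
    finally show ?thesis .
  qed
  have commute: "I g h = I h g" if [measurable]: "g \<in> borel_measurable borel" "h \<in> borel_measurable borel" for g h
  proof -
    have "I g h = (\<integral>\<^sup>+z. (\<integral>\<^sup>+y. ennreal (g y * h z) * f (y - z) \<partial>lborel) \<partial>lborel)"
      unfolding I_def by (rule lborel_pair.Fubini'[symmetric]) measurable
    also have "\<dots> = I h g"
      unfolding I_def
    proof (intro nn_integral_cong)
      fix y z :: 'a
      show "ennreal (g z * h y) * f (z - y) = ennreal (h y * g z) * f (y - z)"
        using sym[of "y - z"] by (simp add: mult.commute)
    qed
    finally show ?thesis .
  qed
  have shift: "I q h = (\<integral>\<^sup>+y. (\<integral>\<^sup>+z. ennreal (p y * h z) * f (x + y - z) \<partial>lborel) \<partial>lborel)"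
    if [measurable]: "h \<in> borel_measurable borel" for h
    unfolding I_def
    using nn_integral_lborel_translate[of "\<lambda>y. \<integral>\<^sup>+z. ennreal (q y * h z) * f (y - z) \<partial>lborel" x]
    by (simp add: q_def add.commute)
  have pp: "I p p = shifted_energy f p 0" by (simp add: I_def shifted_energy_def)
  have qp: "I q p = shifted_energy f p x" unfolding shifted_energy_def by (rule shift) measurable
  have qq: "I q q = I p p"
  proof -
    have "I q q = (\<integral>\<^sup>+y. (\<integral>\<^sup>+z. ennreal (p y * q z) * f (x + y - z) \<partial>lborel) \<partial>lborel)"
      by (rule shift) measurable
    also have "\<dots> = I p p"
      unfolding I_def
    proof (rule nn_integral_cong)
      fix y :: 'a
      show "(\<integral>\<^sup>+z. ennreal (p y * q z) * f (x + y - z) \<partial>lborel) = (\<integral>\<^sup>+z. ennreal (p y * p z) * f (y - z) \<partial>lborel)"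
        using nn_integral_lborel_translate[of "\<lambda>z. ennreal (p y * q z) * f (x + y - z)" x]
        by (simp add: q_def algebra_simps)
    qed
    finally show ?thesis .
  qed
  have "energy f (\<lambda>y. p y + p (y - x)) = I (\<lambda>y. p y + q y) (\<lambda>y. p y + q y)"
    by (simp add: energy_def I_def q_def)
  also have "\<dots> = I p (\<lambda>y. p y + q y) + I q (\<lambda>y. p y + q y)"
    by (rule add_left) (use p0 q0 in \<open>simp_all add: add_nonneg_nonneg\<close>)
  also have "I p (\<lambda>y. p y + q y) = I p p + I q p"
    by (subst commute, simp, simp, rule add_left) (use p0 q0 in simp_all)
  also have "I q (\<lambda>y. p y + q y) = I p q + I q q"
    by (subst commute, simp, simp, rule add_left) (use p0 q0 in simp_all)
  also have "I p q = I q p" by (rule commute) measurable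
  finally show ?thesis
    unfolding qq pp qp by (simp add: mult_2 ac_simps)
qed

lemma fourier_add_translate:
  fixes p :: "'a::euclidean_space \<Rightarrow> real"
  assumes p: "integrable lborel p"
  shows "(cmod (fourier (\<lambda>y. of_real (p y + p (y - x))) \<xi>))\<^sup>2 = 2 * ((cmod (fourier (\<lambda>y. of_real (p y)) \<xi>))\<^sup>2 * (1 + cos (x \<bullet> \<xi>)))"
proof -
  let ?P = "fourier (\<lambda>y. complex_of_real (p y)) \<xi>"
  have [measurable]: "p \<in> borel_measurable borel" using p by auto
  have px: "integrable lborel (\<lambda>y. p (y - x))" using lborel_translate(1)[OF p, of "- x"] by simp
  have i: "integrable lborel (\<lambda>y. iexp (y \<bullet> \<xi>) * complex_of_real (p y))"
    by (rule Bochner_Integration.integrable_bound[OF p]) (auto simp: norm_mult)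
  have ix: "integrable lborel (\<lambda>y. iexp (y \<bullet> \<xi>) * complex_of_real (p (y - x)))"
    by (rule Bochner_Integration.integrable_bound[OF px]) (auto simp: norm_mult)
  have "(LINT y|lborel. iexp (y \<bullet> \<xi>) * complex_of_real (p (y - x)))
      = (LINT y|lborel. iexp ((y + x) \<bullet> \<xi>) * complex_of_real (p (y + x - x)))"
    by (rule lborel_translate(2)[symmetric])
  also have "\<dots> = (LINT y|lborel. iexp (x \<bullet> \<xi>) * (iexp (y \<bullet> \<xi>) * complex_of_real (p y)))"
    by (intro Bochner_Integration.integral_cong refl)
      (simp add: inner_add_left distrib_left exp_add)
  finally have "fourier (\<lambda>y. complex_of_real (p y + p (y - x))) \<xi> = (1 + iexp (x \<bullet> \<xi>)) * ?P"
    unfolding fourier_def by (simp add: distrib_left distrib_right Bochner_Integration.integral_add[OF i ix])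
  moreover have "(cmod (1 + iexp (x \<bullet> \<xi>)))\<^sup>2 = 2 * (1 + cos (x \<bullet> \<xi>))"
  proof -
    have "(cmod (1 + iexp (x \<bullet> \<xi>)))\<^sup>2 = (1 + cos (x \<bullet> \<xi>))\<^sup>2 + (sin (x \<bullet> \<xi>))\<^sup>2"
      unfolding cmod_power2 by (simp add: Re_exp Im_exp)
    then show ?thesis
      using sin_cos_squared_add[of "x \<bullet> \<xi>"] by (simp add: power2_eq_square algebra_simps)
  qed
  ultimately show ?thesis by (simp add: norm_mult power_mult_distrib)
qed

text \<open>The Fourier transform of \<open>p\<close> plus its translate by \<open>x\<close> carries the factor \<open>1 + exp (i x \<bullet> \<xi>)\<close>,
  whose squared modulus is \<open>2 * (1 + cos (x \<bullet> \<xi>))\<close>. The sum on the left is kept together since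
  isolating the second term would require subtracting a possibly infinite quantity.\<close>

lemma shifted_energy_spectral:
  fixes f fhat :: "'a::euclidean_space \<Rightarrow> ennreal"
  assumes ft: "has_fourier_transform f fhat" and sym: "\<And>x. f (- x) = f x"
    and p: "integrable lborel p" and p0: "\<And>x. 0 \<le> p x"
  shows "shifted_energy f p 0 + shifted_energy f p x = ennreal (1 / (2 * pi) ^ DIM('a)) *
    (\<integral>\<^sup>+\<xi>. fhat \<xi> * ennreal ((cmod (fourier (\<lambda>y. of_real (p y)) \<xi>))\<^sup>2 * (1 + cos (x \<bullet> \<xi>))) \<partial>lborel)"
proof -
  have temp: "tempered f" "tempered fhat" using ft by (auto simp: has_fourier_transform_def)
  note [measurable] = tempered_measurable[OF temp(1)] tempered_measurable[OF temp(2)]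
  have [measurable]: "p \<in> borel_measurable borel" using p by auto
  let ?P = "\<lambda>\<xi>. (cmod (fourier (\<lambda>y. of_real (p y)) \<xi>))\<^sup>2 * (1 + cos (x \<bullet> \<xi>))"
  let ?c = "ennreal (1 / (2 * pi) ^ DIM('a))"
  have px: "integrable lborel (\<lambda>y. p (y - x))" using lborel_translate(1)[OF p, of "- x"] by simp
  have "2 * (shifted_energy f p 0 + shifted_energy f p x) = energy f (\<lambda>y. p y + p (y - x))"
    by (rule energy_add_translate[symmetric]) (use sym p0 in auto)
  also have "\<dots> = spectral_energy fhat (\<lambda>y. p y + p (y - x))"
    by (rule energy_eq_spectral_energy[OF ft]) (use p px p0 in auto)
  also have "\<dots> = ?c * (\<integral>\<^sup>+\<xi>. 2 * (fhat \<xi> * ennreal (?P \<xi>)) \<partial>lborel)"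
    unfolding spectral_energy_def fourier_add_translate[OF p]
    by (simp only: ennreal_mult' zero_le_numeral ennreal_numeral mult.left_commute)
  also have "\<dots> = 2 * (?c * (\<integral>\<^sup>+\<xi>. fhat \<xi> * ennreal (?P \<xi>) \<partial>lborel))"
    by (subst nn_integral_cmult) (auto simp: mult_ac)
  finally show ?thesis
    by (simp only: ennreal_mult_cancel_left) simp
qed

section \<open>The replica semigroup and its Laplace transform\<close>

text \<open>A density with values in \<open>[0, \<infinity>]\<close> is finite almost everywhere, so it may be replaced by a real one.\<close>

lemma distributed_real_density:
  fixes Y :: "'w \<Rightarrow> 'a::euclidean_space"
  assumes M: "prob_space M" and Y: "distributed M lborel Y q"
  defines "p \<equiv> \<lambda>y. enn2real (q y)"
  shows "integrable lborel p" and "(LINT y|lborel. p y) = 1"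
    and "g \<in> borel_measurable borel \<Longrightarrow> (\<integral>\<^sup>+\<omega>. g (Y \<omega>) \<partial>M) = (\<integral>\<^sup>+y. ennreal (p y) * g y \<partial>lborel)"
    and "fourier (\<lambda>y. of_real (p y)) \<xi> = (LINT \<omega>|M. iexp (\<xi> \<bullet> Y \<omega>))"
proof -
  interpret prob_space M by fact
  have [measurable]: "q \<in> borel_measurable borel" "Y \<in> M \<rightarrow>\<^sub>M borel"
    using Y by (auto simp: distributed_def)
  have [measurable]: "p \<in> borel_measurable borel" unfolding p_def by measurable
  have one: "(\<integral>\<^sup>+y. q y \<partial>lborel) = 1"
    using distributed_nn_integral[OF Y, of "\<lambda>_. 1"] emeasure_space_1 by simp
  then have "AE y in lborel. q y \<noteq> \<infinity>" by (intro nn_integral_PInf_AE) auto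
  then have AE: "AE y in lborel. q y = ennreal (p y)"
    by eventually_elim (simp add: p_def less_top)
  have one': "(\<integral>\<^sup>+y. ennreal (p y) \<partial>lborel) = 1"
    unfolding one[symmetric] using AE by (intro nn_integral_cong_AE) (auto elim: eventually_mono)
  show p: "integrable lborel p"
    by (rule integrableI_nonneg) (auto simp: one', simp add: p_def)
  show "(LINT y|lborel. p y) = 1"
    by (subst integral_eq_nn_integral) (auto simp: one', simp add: p_def)
  show "(\<integral>\<^sup>+\<omega>. g (Y \<omega>) \<partial>M) = (\<integral>\<^sup>+y. ennreal (p y) * g y \<partial>lborel)" if "g \<in> borel_measurable borel"
  proof -
    have "(\<integral>\<^sup>+\<omega>. g (Y \<omega>) \<partial>M) = (\<integral>\<^sup>+y. q y * g y \<partial>lborel)"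
      by (rule distributed_nn_integral[OF Y, symmetric]) (use that in simp)
    also have "\<dots> = (\<integral>\<^sup>+y. ennreal (p y) * g y \<partial>lborel)"
      using AE by (intro nn_integral_cong_AE) (auto elim: eventually_mono)
    finally show ?thesis .
  qed
  have "distr M lborel Y = density lborel (\<lambda>y. ennreal (p y))"
    using Y AE density_cong[of q lborel "\<lambda>y. ennreal (p y)"] by (simp add: distributed_def)
  then have "(LINT y|distr M lborel Y. iexp (\<xi> \<bullet> y)) = (LINT y|density lborel (\<lambda>y. ennreal (p y)). iexp (\<xi> \<bullet> y))"
    by simp
  then show "fourier (\<lambda>y. of_real (p y)) \<xi> = (LINT \<omega>|M. iexp (\<xi> \<bullet> Y \<omega>))"
    unfolding fourier_def
    by (subst (asm) integral_distr, simp, measurable, subst (asm) integral_density)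
      (auto simp: p_def scaleR_conv_of_real mult.commute inner_commute)
qed

text \<open>The independence and the law of the copy are given for whole paths; evaluating at time \<open>t\<close> shows that
  the replica at time \<open>t\<close> is the difference of two independent variables with the law of \<open>X t\<close>.\<close>

lemma replica_transition_semigroup:
  fixes X Xstar :: "real \<Rightarrow> 'w \<Rightarrow> 'a::euclidean_space"
  assumes M: "prob_space M" and X: "\<forall>t\<ge>0. X t \<in> borel_measurable M"
    and copy: "independent_copy_of_neg M X Xstar"
    and t: "t \<ge> 0" and Y: "distributed M lborel (X t) q"
    and [measurable]: "f \<in> borel_measurable borel"
  shows "transition_semigroup M (replica X Xstar) t f x = shifted_energy f (\<lambda>y. enn2real (q y)) x"
proof -
  interpret prob_space M by fact
  let ?p = "\<lambda>y. enn2real (q y)"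
  note dens = distributed_real_density[OF M Y]
  have [measurable]: "?p \<in> borel_measurable borel" using dens(1) by auto
  have coord[measurable]: "(\<lambda>\<pi>. \<pi> t) \<in> path_space \<rightarrow>\<^sub>M (borel :: 'a measure)"
    by (rule measurable_component_singleton) (use t in auto)
  have path: "(\<lambda>\<pi>. \<pi> t) \<circ> path_of Z = Z t" for Z :: "real \<Rightarrow> 'w \<Rightarrow> 'a"
    using t by (auto simp: path_of_def)
  have ind: "indep_var path_space (path_of X) path_space (path_of Xstar)"
    and law: "distr M path_space (path_of Xstar) = distr M path_space (path_of (\<lambda>t \<omega>. - X t \<omega>))"
    using copy by (auto simp: independent_copy_of_neg_def)
  have indt: "indep_var borel (X t) borel (Xstar t)"
    using indep_var_compose[OF ind coord coord] by (simp only: path)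
  have [measurable]: "X t \<in> borel_measurable M" "Xstar t \<in> borel_measurable M"
    using indep_var_rv1[OF indt] indep_var_rv2[OF indt] by auto
  have "path_of (\<lambda>t \<omega>. - X t \<omega>) \<in> M \<rightarrow>\<^sub>M path_space"
    unfolding path_of_def using X by (intro measurable_restrict) auto
  then have lawt: "distr M borel (Xstar t) = distr M borel (\<lambda>\<omega>. - X t \<omega>)"
    using arg_cong[OF law, of "\<lambda>N. distr N borel (\<lambda>\<pi>. \<pi> t)"] indep_var_rv2[OF ind]
    by (simp add: distr_distr path)
  interpret D: prob_space "distr M borel (Xstar t)" by (rule prob_space_distr) simp
  have "transition_semigroup M (replica X Xstar) t f x = (\<integral>\<^sup>+\<omega>. (\<lambda>(u, v). f (x + u + v)) (X t \<omega>, Xstar t \<omega>) \<partial>M)"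
    by (simp add: transition_semigroup_def replica_def add.assoc)
  also have "\<dots> = (\<integral>\<^sup>+w. (\<lambda>(u, v). f (x + u + v)) w \<partial>distr M (borel \<Otimes>\<^sub>M borel) (\<lambda>\<omega>. (X t \<omega>, Xstar t \<omega>)))"
    by (rule nn_integral_distr[symmetric]) measurable
  also have "distr M (borel \<Otimes>\<^sub>M borel) (\<lambda>\<omega>. (X t \<omega>, Xstar t \<omega>)) = distr M borel (X t) \<Otimes>\<^sub>M distr M borel (Xstar t)"
    using indt by (simp add: indep_var_distribution_eq)
  also have "(\<integral>\<^sup>+w. (\<lambda>(u, v). f (x + u + v)) w \<partial>(distr M borel (X t) \<Otimes>\<^sub>M distr M borel (Xstar t)))
      = (\<integral>\<^sup>+u. (\<integral>\<^sup>+v. f (x + u + v) \<partial>distr M borel (Xstar t)) \<partial>distr M borel (X t))"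
    by (subst D.nn_integral_fst[symmetric]) simp_all
  also have "\<dots> = (\<integral>\<^sup>+\<omega>. (\<integral>\<^sup>+\<omega>'. f (x + X t \<omega> - X t \<omega>') \<partial>M) \<partial>M)"
    unfolding lawt by (simp add: nn_integral_distr)
  also have "\<dots> = (\<integral>\<^sup>+\<omega>. (\<lambda>y. \<integral>\<^sup>+z. ennreal (?p z) * f (x + y - z) \<partial>lborel) (X t \<omega>) \<partial>M)"
    by (intro nn_integral_cong) (simp add: dens(3)[of "\<lambda>z. f (x + X t _ - z)"])
  also have "\<dots> = (\<integral>\<^sup>+y. ennreal (?p y) * (\<integral>\<^sup>+z. ennreal (?p z) * f (x + y - z) \<partial>lborel) \<partial>lborel)"
    by (rule dens(3)) measurable
  also have "\<dots> = shifted_energy f ?p x"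
    unfolding shifted_energy_def
    by (intro nn_integral_cong) (simp add: nn_integral_cmult[symmetric] ennreal_mult mult.assoc)
  finally show ?thesis .
qed

lemma nn_integral_exp_atLeast_0:
  assumes "l > (0::real)"
  shows "(\<integral>\<^sup>+s. ennreal (exp (- l * s)) * indicator {0..} s \<partial>lborel) = ennreal (1 / l)"
proof -
  have "(\<integral>\<^sup>+s. ennreal (exp (- l * s)) * indicator {0..} s \<partial>lborel) = ennreal (0 - (- exp (- l * 0) / l))"
  proof (rule nn_integral_FTC_atLeast)
    show "((\<lambda>s. - exp (- l * s) / l) has_real_derivative exp (- l * s)) (at s)" for s
      using assms by (auto intro!: derivative_eq_intros)
    have "((\<lambda>s. exp (- l * s)) \<longlongrightarrow> 0) at_top"
      using assms by (intro filterlim_compose[OF exp_at_bot] filterlim_tendsto_neg_mult_at_bot[OF tendsto_const _ filterlim_ident]) auto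
    from tendsto_mult_right[OF this, of "- 1 / l"] show "((\<lambda>s. - exp (- l * s) / l) \<longlongrightarrow> 0) at_top"
      by simp
  qed auto
  then show ?thesis by simp
qed

text \<open>Tonelli's theorem and the integral of \<open>exp (- (\<beta> + 2 * \<rho> \<xi>) * s)\<close> over \<open>s \<ge> 0\<close>. In the application
  \<open>w\<close> is either constant or \<open>1 + cos (x \<bullet> \<xi>)\<close>.\<close>

lemma laplace_transform_spectral:
  fixes h :: "'a::euclidean_space \<Rightarrow> ennreal" and w \<rho> :: "'a \<Rightarrow> real"
  assumes [measurable]: "h \<in> borel_measurable borel" "w \<in> borel_measurable borel" "\<rho> \<in> borel_measurable borel"
    and w: "\<And>\<xi>. 0 \<le> w \<xi>" and \<rho>: "\<And>\<xi>. 0 \<le> \<rho> \<xi>" and \<beta>: "\<beta> > 0"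
  shows "(\<integral>\<^sup>+s\<in>{0..}. ennreal (exp (- \<beta> * s)) * (c * (\<integral>\<^sup>+\<xi>. h \<xi> * ennreal (exp (- 2 * s * \<rho> \<xi>) * w \<xi>) \<partial>lborel)) \<partial>lborel)
    = c * (\<integral>\<^sup>+\<xi>. h \<xi> * ennreal (1 / (\<beta> + 2 * \<rho> \<xi>) * w \<xi>) \<partial>lborel)"
proof -
  have "(\<integral>\<^sup>+s\<in>{0..}. ennreal (exp (- \<beta> * s)) * (c * (\<integral>\<^sup>+\<xi>. h \<xi> * ennreal (exp (- 2 * s * \<rho> \<xi>) * w \<xi>) \<partial>lborel)) \<partial>lborel)
    = c * (\<integral>\<^sup>+s. (\<integral>\<^sup>+\<xi>. ennreal (exp (- \<beta> * s)) * indicator {0..} s * (h \<xi> * ennreal (exp (- 2 * s * \<rho> \<xi>) * w \<xi>)) \<partial>lborel) \<partial>lborel)"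
    by (simp add: nn_integral_cmult[symmetric] mult_ac)
  also have "(\<integral>\<^sup>+s. (\<integral>\<^sup>+\<xi>. ennreal (exp (- \<beta> * s)) * indicator {0..} s * (h \<xi> * ennreal (exp (- 2 * s * \<rho> \<xi>) * w \<xi>)) \<partial>lborel) \<partial>lborel)
     = (\<integral>\<^sup>+\<xi>. (\<integral>\<^sup>+s. ennreal (exp (- \<beta> * s)) * indicator {0..} s * (h \<xi> * ennreal (exp (- 2 * s * \<rho> \<xi>) * w \<xi>)) \<partial>lborel) \<partial>lborel)"
    by (rule lborel_pair.Fubini'[symmetric]) measurable
  also have "\<dots> = (\<integral>\<^sup>+\<xi>. h \<xi> * ennreal (1 / (\<beta> + 2 * \<rho> \<xi>) * w \<xi>) \<partial>lborel)"
  proof (rule nn_integral_cong)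
    fix \<xi> :: 'a
    have "(\<integral>\<^sup>+s. ennreal (exp (- \<beta> * s)) * indicator {0..} s * (h \<xi> * ennreal (exp (- 2 * s * \<rho> \<xi>) * w \<xi>)) \<partial>lborel)
      = (\<integral>\<^sup>+s. h \<xi> * ennreal (w \<xi>) * (ennreal (exp (- (\<beta> + 2 * \<rho> \<xi>) * s)) * indicator {0..} s) \<partial>lborel)"
    proof (rule nn_integral_cong)
      fix s :: real
      have "exp (- (\<beta> + 2 * \<rho> \<xi>) * s) = exp (- \<beta> * s) * exp (- 2 * s * \<rho> \<xi>)"
        by (simp add: exp_add[symmetric] algebra_simps)
      then show "ennreal (exp (- \<beta> * s)) * indicator {0..} s * (h \<xi> * ennreal (exp (- 2 * s * \<rho> \<xi>) * w \<xi>))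
        = h \<xi> * ennreal (w \<xi>) * (ennreal (exp (- (\<beta> + 2 * \<rho> \<xi>) * s)) * indicator {0..} s)"
        by (simp only: ennreal_mult w exp_ge_zero mult_ac)
    qed
    also have "\<dots> = h \<xi> * ennreal (w \<xi>) * ennreal (1 / (\<beta> + 2 * \<rho> \<xi>))"
      using \<beta> \<rho>[of \<xi>] by (subst nn_integral_cmult) (simp_all only: nn_integral_exp_atLeast_0 add_pos_nonneg mult_nonneg_nonneg zero_le_numeral, measurable)
    also have "\<dots> = h \<xi> * ennreal (1 / (\<beta> + 2 * \<rho> \<xi>) * w \<xi>)"
      unfolding ennreal_mult''[OF w] by (simp only: mult_ac)
    finally show "(\<integral>\<^sup>+s. ennreal (exp (- \<beta> * s)) * indicator {0..} s * (h \<xi> * ennreal (exp (- 2 * s * \<rho> \<xi>) * w \<xi>)) \<partial>lborel)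
      = h \<xi> * ennreal (1 / (\<beta> + 2 * \<rho> \<xi>) * w \<xi>)" .
  qed
  finally show ?thesis .
qed

section \<open>The resolvent of the replica process\<close>

text \<open>The spectral formula for the semigroup holds at positive times, while the resolvent integrates from
  time \<open>0\<close>.\<close>

lemma nn_integral_atLeast_0_cong:
  fixes g h :: "real \<Rightarrow> ennreal"
  assumes "AE s in lborel. s > 0 \<longrightarrow> g s = h s"
  shows "(\<integral>\<^sup>+s\<in>{0..}. g s \<partial>lborel) = (\<integral>\<^sup>+s\<in>{0..}. h s \<partial>lborel)"
  using assms AE_lborel_singleton[of "0::real"]
  by (intro nn_integral_cong_AE) (auto elim!: eventually_elim2 simp: indicator_def)

text \<open>The family \<open>T\<close> stands for the semigroup applied to \<open>f\<close>. The case \<open>x = 0\<close> of its hypothesis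
  determines \<open>T s 0\<close>, and integrating over time gives the value of the resolvent at the origin. As
  \<open>1 + cos\<close> is at most \<open>2\<close>, the integrated hypothesis says that \<open>R 0 + R x\<close> is at most \<open>2 * R 0\<close>,
  hence that the maximum is attained at the origin.\<close>

lemma resolvent_spectral_identities:
  fixes T :: "real \<Rightarrow> 'a::euclidean_space \<Rightarrow> ennreal" and h :: "'a \<Rightarrow> ennreal" and \<rho> :: "'a \<Rightarrow> real" and c :: ennreal
  assumes [measurable]: "h \<in> borel_measurable borel" "\<rho> \<in> borel_measurable borel"
    and \<rho>: "\<And>\<xi>. 0 \<le> \<rho> \<xi>" and \<beta>: "\<beta> > 0" and c: "c < \<infinity>"
    and T: "\<forall>s>0. \<forall>x. T s 0 + T s x =
       c * (\<integral>\<^sup>+\<xi>. h \<xi> * ennreal (exp (- 2 * s * \<rho> \<xi>) * (1 + cos (x \<bullet> \<xi>))) \<partial>lborel)"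
  defines "R \<equiv> \<lambda>x. \<integral>\<^sup>+s\<in>{0..}. ennreal (exp (- \<beta> * s)) * T s x \<partial>lborel"
    and "U \<equiv> c * (\<integral>\<^sup>+\<xi>. h \<xi> * ennreal (1 / (\<beta> + 2 * \<rho> \<xi>)) \<partial>lborel)"
  shows "R 0 = U"
    and "U < \<infinity> \<Longrightarrow> R 0 + R x = c * (\<integral>\<^sup>+\<xi>. h \<xi> * ennreal (1 / (\<beta> + 2 * \<rho> \<xi>) * (1 + cos (x \<bullet> \<xi>))) \<partial>lborel)"
    and "R x \<le> U"
proof -
  have cos1: "0 \<le> 1 + cos (x \<bullet> \<xi>)" for x \<xi> :: 'a
    using cos_ge_minus_one[of "x \<bullet> \<xi>"] by linarith
  define K where "K x s = c * (\<integral>\<^sup>+\<xi>. h \<xi> * ennreal (exp (- 2 * s * \<rho> \<xi>) * (1 + cos (x \<bullet> \<xi>))) \<partial>lborel)" for x s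
  define K0 where "K0 s = c * (\<integral>\<^sup>+\<xi>. h \<xi> * ennreal (exp (- 2 * s * \<rho> \<xi>) * 1) \<partial>lborel)" for s
  have [measurable]: "K x \<in> borel_measurable borel" "K0 \<in> borel_measurable borel" for x
    unfolding K_def[abs_def] K0_def[abs_def] by measurable
  have T0: "T s 0 = K0 s" if "s > 0" for s
  proof -
    have "ennreal (exp (- 2 * s * \<rho> \<xi>) * (1 + cos (0 \<bullet> \<xi>))) = 2 * ennreal (exp (- 2 * s * \<rho> \<xi>) * 1)" for \<xi>
      using ennreal_mult'[of 2 "exp (- 2 * s * \<rho> \<xi>)"] by (simp add: mult.commute)
    then have "2 * T s 0 = c * (\<integral>\<^sup>+\<xi>. 2 * (h \<xi> * ennreal (exp (- 2 * s * \<rho> \<xi>) * 1)) \<partial>lborel)"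
      using T[rule_format, OF that, of 0] by (simp only: mult_2[symmetric] mult.left_commute[of "h _" 2])
    also have "\<dots> = 2 * K0 s"
      unfolding K0_def by (subst nn_integral_cmult) (auto simp: mult_ac)
    finally show ?thesis by (simp only: ennreal_mult_cancel_left) simp
  qed
  have TK: "K0 s + T s x = K x s" if "s > 0" for s x
    using T[rule_format, OF that, of x] T0[OF that] by (simp add: K_def)
  have R0: "R 0 = (\<integral>\<^sup>+s\<in>{0..}. ennreal (exp (- \<beta> * s)) * K0 s \<partial>lborel)"
    unfolding R_def by (rule nn_integral_atLeast_0_cong) (simp add: T0)
  also have "\<dots> = c * (\<integral>\<^sup>+\<xi>. h \<xi> * ennreal (1 / (\<beta> + 2 * \<rho> \<xi>) * 1) \<partial>lborel)"
    unfolding K0_def by (rule laplace_transform_spectral) (use \<rho> \<beta> in auto)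
  finally show R0U: "R 0 = U" by (simp add: U_def)
  show sum: "R 0 + R x = c * (\<integral>\<^sup>+\<xi>. h \<xi> * ennreal (1 / (\<beta> + 2 * \<rho> \<xi>) * (1 + cos (x \<bullet> \<xi>))) \<partial>lborel)"
    if fin: "U < \<infinity>" for x
  proof -
    \<comment> \<open>The hypothesis on T says nothing about measurability in time. Where K0 is finite, T s x is the
      difference of two measurable functions, and finiteness of U makes this true for almost all
      times.\<close>
    have "AE s in lborel. ennreal (exp (- \<beta> * s)) * K0 s * indicator {0..} s \<noteq> \<infinity>"
      using fin unfolding R0U[symmetric] R0 by (intro nn_integral_PInf_AE) auto
    then have K0fin: "AE s in lborel. s > 0 \<longrightarrow> K0 s < \<infinity>"
      by eventually_elim (auto simp: ennreal_mult_eq_top_iff less_top indicator_def split: if_splits)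
    have Rx: "R x = (\<integral>\<^sup>+s\<in>{0..}. ennreal (exp (- \<beta> * s)) * (K x s - K0 s) \<partial>lborel)"
      unfolding R_def
    proof (rule nn_integral_atLeast_0_cong)
      show "AE s in lborel. s > 0 \<longrightarrow> ennreal (exp (- \<beta> * s)) * T s x = ennreal (exp (- \<beta> * s)) * (K x s - K0 s)"
        using K0fin by eventually_elim (auto simp: TK[symmetric])
    qed
    have "R 0 + R x = (\<integral>\<^sup>+s. ennreal (exp (- \<beta> * s)) * K0 s * indicator {0..} s + ennreal (exp (- \<beta> * s)) * (K x s - K0 s) * indicator {0..} s \<partial>lborel)"
      unfolding R0 Rx by (rule nn_integral_add[symmetric]) measurable
    also have "\<dots> = (\<integral>\<^sup>+s\<in>{0..}. ennreal (exp (- \<beta> * s)) * (K0 s + (K x s - K0 s)) \<partial>lborel)"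
      by (simp add: distrib_left distrib_right)
    also have "\<dots> = (\<integral>\<^sup>+s\<in>{0..}. ennreal (exp (- \<beta> * s)) * K x s \<partial>lborel)"
    proof (rule nn_integral_atLeast_0_cong)
      show "AE s in lborel. s > 0 \<longrightarrow> ennreal (exp (- \<beta> * s)) * (K0 s + (K x s - K0 s)) = ennreal (exp (- \<beta> * s)) * K x s"
        using K0fin by eventually_elim (auto simp: TK[symmetric])
    qed
    also have "\<dots> = c * (\<integral>\<^sup>+\<xi>. h \<xi> * ennreal (1 / (\<beta> + 2 * \<rho> \<xi>) * (1 + cos (x \<bullet> \<xi>))) \<partial>lborel)"
      unfolding K_def by (rule laplace_transform_spectral) (use \<rho> \<beta> cos1 in auto)
    finally show ?thesis .
  qed
  show "R x \<le> U"
  proof (cases "U < \<infinity>")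
    case True
    have "U + R x \<le> c * (\<integral>\<^sup>+\<xi>. 2 * (h \<xi> * ennreal (1 / (\<beta> + 2 * \<rho> \<xi>))) \<partial>lborel)"
      unfolding sum[OF True, unfolded R0U]
    proof (intro mult_left_mono[OF nn_integral_mono] zero_le)
      fix \<xi> :: 'a
      have "1 / (\<beta> + 2 * \<rho> \<xi>) * (1 + cos (x \<bullet> \<xi>)) \<le> 1 / (\<beta> + 2 * \<rho> \<xi>) * 2"
        using \<rho>[of \<xi>] \<beta> cos_le_one[of "x \<bullet> \<xi>"] by (intro mult_left_mono) auto
      then have "ennreal (1 / (\<beta> + 2 * \<rho> \<xi>) * (1 + cos (x \<bullet> \<xi>))) \<le> ennreal (1 / (\<beta> + 2 * \<rho> \<xi>) * 2)"
        by (rule ennreal_leI)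
      also have "\<dots> = 2 * ennreal (1 / (\<beta> + 2 * \<rho> \<xi>))"
        by (subst ennreal_mult'') (simp_all only: ennreal_numeral zero_le_numeral mult.commute)
      finally have "ennreal (1 / (\<beta> + 2 * \<rho> \<xi>) * (1 + cos (x \<bullet> \<xi>))) \<le> 2 * ennreal (1 / (\<beta> + 2 * \<rho> \<xi>))" .
      from mult_left_mono[OF this zero_le, of "h \<xi>"]
      show "h \<xi> * ennreal (1 / (\<beta> + 2 * \<rho> \<xi>) * (1 + cos (x \<bullet> \<xi>))) \<le> 2 * (h \<xi> * ennreal (1 / (\<beta> + 2 * \<rho> \<xi>)))"
        by (simp only: mult.left_commute)
    qed
    also have "\<dots> = U + U"
      unfolding U_def mult_2[symmetric] by (subst nn_integral_cmult) (simp_all add: mult.left_commute)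
    finally show ?thesis using True by (auto simp: ennreal_add_left_cancel_le)
  next
    case False
    then show ?thesis by (simp add: less_top[symmetric])
  qed
qed

text \<open>When the resolvent is finite at the origin, \<open>R 0\<close> can be subtracted from \<open>R 0 + R x\<close>. What remains is
  the cosine transform of an integrable function, which belongs to \<open>C0\<close> by the Riemann--Lebesgue
  lemma.\<close>

lemma resolvent_C0_version:
  fixes T :: "real \<Rightarrow> 'a::euclidean_space \<Rightarrow> ennreal" and h :: "'a \<Rightarrow> ennreal" and \<rho> :: "'a \<Rightarrow> real" and c :: real
  assumes [measurable]: "h \<in> borel_measurable borel" "\<rho> \<in> borel_measurable borel"
    and hfin: "AE \<xi> in lborel. h \<xi> < \<infinity>"
    and \<rho>: "\<And>\<xi>. 0 \<le> \<rho> \<xi>" and \<beta>: "\<beta> > 0" and c: "c > 0"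
    and T: "\<forall>s>0. \<forall>x. T s 0 + T s x =
       ennreal c * (\<integral>\<^sup>+\<xi>. h \<xi> * ennreal (exp (- 2 * s * \<rho> \<xi>) * (1 + cos (x \<bullet> \<xi>))) \<partial>lborel)"
    and fin: "ennreal c * (\<integral>\<^sup>+\<xi>. h \<xi> * ennreal (1 / (\<beta> + 2 * \<rho> \<xi>)) \<partial>lborel) < \<infinity>"
  shows "\<exists>\<pi>\<in>C0. \<forall>x. enn2ereal (\<integral>\<^sup>+s\<in>{0..}. ennreal (exp (- \<beta> * s)) * T s x \<partial>lborel) = ereal (\<pi> x)"
proof -
  let ?R = "\<lambda>x. \<integral>\<^sup>+s\<in>{0..}. ennreal (exp (- \<beta> * s)) * T s x \<partial>lborel"
  note ids = resolvent_spectral_identities[where c="ennreal c", OF assms(1,2) \<rho> \<beta> ennreal_less_top[of c, folded infinity_ennreal_def] T]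
  have r: "0 \<le> 1 / (\<beta> + 2 * \<rho> \<xi>)" for \<xi> using \<rho>[of \<xi>] \<beta> by simp
  have cos1: "0 \<le> 1 + cos (x \<bullet> \<xi>)" for x \<xi> :: 'a
    using cos_ge_minus_one[of "x \<bullet> \<xi>"] by linarith
  define k where "k \<xi> = c * (enn2real (h \<xi>) * (1 / (\<beta> + 2 * \<rho> \<xi>)))" for \<xi>
  have fin': "(\<integral>\<^sup>+\<xi>. h \<xi> * ennreal (1 / (\<beta> + 2 * \<rho> \<xi>)) \<partial>lborel) < \<infinity>"
    using fin c by (auto simp: ennreal_mult_less_top)
  have k: "integrable lborel k"
    unfolding k_def[abs_def]
    by (intro integrable_mult_right lebesgue_integral_enn2real(3)[OF _ _ hfin r fin']) measurable
  have k0: "0 \<le> k \<xi>" for \<xi> using c r[of \<xi>] by (simp add: k_def)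
  have [measurable]: "k \<in> borel_measurable borel" using k by auto
  have eq: "ennreal c * (\<integral>\<^sup>+\<xi>. h \<xi> * ennreal (1 / (\<beta> + 2 * \<rho> \<xi>) * w \<xi>) \<partial>lborel) = ennreal (LINT \<xi>|lborel. k \<xi> * w \<xi>)"
    if [measurable]: "w \<in> borel_measurable borel" and w: "\<And>\<xi>. 0 \<le> w \<xi>" and int: "integrable lborel (\<lambda>\<xi>. k \<xi> * w \<xi>)" for w
  proof -
    have "ennreal c * (\<integral>\<^sup>+\<xi>. h \<xi> * ennreal (1 / (\<beta> + 2 * \<rho> \<xi>) * w \<xi>) \<partial>lborel)
       = ennreal c * (\<integral>\<^sup>+\<xi>. ennreal (enn2real (h \<xi>) * (1 / (\<beta> + 2 * \<rho> \<xi>) * w \<xi>)) \<partial>lborel)"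
      by (subst lebesgue_integral_enn2real(1)[OF _ _ hfin mult_nonneg_nonneg[OF r w]]) simp_all
    also have "\<dots> = (\<integral>\<^sup>+\<xi>. ennreal (k \<xi> * w \<xi>) \<partial>lborel)"
      using c by (subst nn_integral_cmult[symmetric]) (auto simp: k_def ennreal_mult'[symmetric] mult_ac)
    also have "\<dots> = ennreal (LINT \<xi>|lborel. k \<xi> * w \<xi>)"
      by (intro nn_integral_eq_integral int) (simp add: k0 w)
    finally show ?thesis .
  qed
  define \<pi> where "\<pi> x = (LINT \<xi>|lborel. k \<xi> * cos (x \<bullet> \<xi>))" for x
  have "\<pi> \<in> C0" unfolding \<pi>_def[abs_def] by (rule Riemann_Lebesgue_C0[OF k])
  moreover have "enn2ereal (?R x) = ereal (\<pi> x)" for x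
  proof -
    have R0: "?R 0 = ennreal (LINT \<xi>|lborel. k \<xi>)"
      using ids(1) eq[of "\<lambda>_. 1"] k by simp
    have i: "integrable lborel (\<lambda>\<xi>. k \<xi> * (1 + cos (x \<bullet> \<xi>)))"
      using k integrable_times_cos[OF k, of x] by (simp add: distrib_left)
    have "?R 0 + ?R x = ennreal (LINT \<xi>|lborel. k \<xi> * (1 + cos (x \<bullet> \<xi>)))"
      unfolding ids(2)[OF fin] by (rule eq) (use cos1 i in auto)
    also have "(LINT \<xi>|lborel. k \<xi> * (1 + cos (x \<bullet> \<xi>))) = (LINT \<xi>|lborel. k \<xi>) + \<pi> x"
      using k integrable_times_cos[OF k, of x] by (simp add: distrib_left \<pi>_def)
    finally have sum: "?R 0 + ?R x = ennreal ((LINT \<xi>|lborel. k \<xi>) + \<pi> x)" .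
    have "?R x < \<infinity>" using ids(3)[of x] fin by (rule le_less_trans)
    then obtain r where r: "?R x = ennreal r" "r \<ge> 0" by (cases "?R x") auto
    have I0: "0 \<le> (LINT \<xi>|lborel. k \<xi>)" by (simp add: k0)
    have "ennreal ((LINT \<xi>|lborel. k \<xi>) + r) = ennreal ((LINT \<xi>|lborel. k \<xi>) + \<pi> x)"
      using sum unfolding R0 r(1) using r(2) I0 by simp
    moreover have "0 \<le> (LINT \<xi>|lborel. k \<xi>) + \<pi> x"
    proof -
      have "0 \<le> (LINT \<xi>|lborel. k \<xi> * (1 + cos (x \<bullet> \<xi>)))"
        by (intro Bochner_Integration.integral_nonneg mult_nonneg_nonneg k0 cos1)
      then show ?thesis
        using k integrable_times_cos[OF k, of x] by (simp add: distrib_left \<pi>_def)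
    qed
    ultimately have "(LINT \<xi>|lborel. k \<xi>) + r = (LINT \<xi>|lborel. k \<xi>) + \<pi> x"
      by (simp only: ennreal_inj add_nonneg_nonneg[OF I0 r(2)])
    then have "\<pi> x = r" by simp
    then show ?thesis
      unfolding r(1) by (simp only: enn2ereal_ennreal r(2))
  qed
  ultimately show ?thesis by blast
qed

theorem theorem1p5:
  fixes M :: "'w measure"
    and X Xstar :: "real \<Rightarrow> 'w \<Rightarrow> 'a::euclidean_space"
    and \<Psi> :: "'a \<Rightarrow> complex"
    and p :: "real \<Rightarrow> 'a \<Rightarrow> ennreal"
    and f fhat :: "'a \<Rightarrow> ennreal"
  defines "Rbar \<equiv> resolvent M (replica X Xstar)"
  assumes levy: "levy_process M X"
    and exponent: "char_exponent M X \<Psi>"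
    and density: "\<And>t. t > 0 \<Longrightarrow> distributed M lborel (X t) (p t)"
    and copy: "independent_copy_of_neg M X Xstar"
    and nonzero: "\<exists>x. f x \<noteq> 0"
    and symmetric: "\<And>x. f (- x) = f x"
    and locint: "locally_integrable f"
    and temp: "tempered f"
    and nonneg_def: "nonneg_definite f"
    and fourier_f: "has_fourier_transform f fhat"
  shows "(\<forall>\<beta>>0. Rbar \<beta> f 0 = (SUP x. Rbar \<beta> f x) \<and> (SUP x. Rbar \<beta> f x) = Upsilon fhat \<Psi> \<beta>)
    \<and> ((\<forall>\<alpha>>0. Rbar \<alpha> f 0 < \<infinity>) \<longleftrightarrow> Upsilon fhat \<Psi> 1 < \<infinity>)
    \<and> (((\<forall>\<alpha>>0. Rbar \<alpha> f 0 < \<infinity>) \<or> Upsilon fhat \<Psi> 1 < \<infinity>) \<and> lower_semicontinuous f \<longrightarrow>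
        (\<forall>\<beta>>0. \<exists>\<pi>\<in>C0. AE x in lborel. enn2ereal (Rbar \<beta> f x) = ereal (\<pi> x)))"
proof -
  have M: "prob_space M" and X: "\<forall>t\<ge>0. X t \<in> borel_measurable M"
    using levy by (auto simp: levy_process_def)
  have tempfhat: "tempered fhat" using fourier_f by (simp add: has_fourier_transform_def)
  note [measurable] = tempered_measurable[OF temp] tempered_measurable[OF tempfhat]
  define c where "c = 1 / (2 * pi) ^ DIM('a)"
  have c: "c > 0" by (simp add: c_def)
  define q where "q t y = enn2real (p t y)" for t y
  have dens_nonneg: "0 \<le> q t y" for t y by (simp add: q_def)
  note dens = distributed_real_density[OF M density, folded q_def]
  have char: "(LINT \<omega>|M. iexp (\<xi> \<bullet> X t \<omega>)) = exp (- of_real t * \<Psi> \<xi>)" if "t \<ge> 0" for t \<xi>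
    using exponent that by (simp add: char_exponent_def)
  have norm_fourier: "cmod (fourier (\<lambda>y. of_real (q t y)) \<xi>) = exp (- t * Re (\<Psi> \<xi>))" if "t > 0" for t \<xi>
    using dens(4)[OF that, of \<xi>] char[of t \<xi>] that by (simp add: norm_exp_eq_Re)
  define \<rho> where "\<rho> \<xi> = Re (\<Psi> \<xi>)" for \<xi>
  \<comment> \<open>This formula shows that Re \<Psi> is measurable.\<close>
  have \<rho>_eq: "\<rho> = (\<lambda>\<xi>. - ln (cmod (fourier (\<lambda>y. of_real (q 1 y)) \<xi>)))"
    by (simp add: norm_fourier \<rho>_def fun_eq_iff)
  have [measurable]: "q 1 \<in> borel_measurable borel" using dens(1)[of 1] by auto
  have [measurable]: "\<rho> \<in> borel_measurable borel" unfolding \<rho>_eq by measurable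
  have \<rho>0: "0 \<le> \<rho> \<xi>" for \<xi>
  proof -
    have "exp (- 1 * Re (\<Psi> \<xi>)) \<le> 1"
      using norm_fourier_le[of "q 1" \<xi>] unfolding norm_fourier[OF zero_less_one] dens(2)[OF zero_less_one]
      by (simp add: q_def)
    then show ?thesis by (simp add: \<rho>_def)
  qed
  define T where "T s x = transition_semigroup M (replica X Xstar) s f x" for s x
  have "T s 0 + T s x = ennreal c * (\<integral>\<^sup>+\<xi>. fhat \<xi> * ennreal (exp (- 2 * s * \<rho> \<xi>) * (1 + cos (x \<bullet> \<xi>))) \<partial>lborel)"
    if s: "s > 0" for s x
  proof -
    have "T s y = shifted_energy f (q s) y" for y
      unfolding T_def q_def[abs_def]
      by (rule replica_transition_semigroup[OF M X copy _ density[OF s]]) (use s in auto)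
    moreover have "(cmod (fourier (\<lambda>y. of_real (q s y)) \<xi>))\<^sup>2 = exp (- 2 * s * \<rho> \<xi>)" for \<xi>
      by (simp add: norm_fourier[OF s] \<rho>_def power2_eq_square exp_add[symmetric])
    ultimately show ?thesis
      using shifted_energy_spectral[OF fourier_f symmetric dens(1)[OF s], of x] by (simp add: c_def dens_nonneg)
  qed
  then have T: "\<forall>s>0. \<forall>x. T s 0 + T s x =
      ennreal c * (\<integral>\<^sup>+\<xi>. fhat \<xi> * ennreal (exp (- 2 * s * \<rho> \<xi>) * (1 + cos (x \<bullet> \<xi>))) \<partial>lborel)"
    by blast
  have Rbar: "Rbar \<beta> f x = (\<integral>\<^sup>+s\<in>{0..}. ennreal (exp (- \<beta> * s)) * T s x \<partial>lborel)" for \<beta> x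
    by (simp add: Rbar_def resolvent_def T_def)
  have Ups: "Upsilon fhat \<Psi> \<beta> = ennreal c * (\<integral>\<^sup>+\<xi>. fhat \<xi> * ennreal (1 / (\<beta> + 2 * \<rho> \<xi>)) \<partial>lborel)" if "\<beta> > 0" for \<beta>
  proof -
    have "inverse (ennreal (\<beta> + 2 * \<rho> \<xi>)) = ennreal (1 / (\<beta> + 2 * \<rho> \<xi>))" for \<xi>
      using \<rho>0[of \<xi>] that by (subst inverse_ennreal) (auto simp: inverse_eq_divide)
    then show ?thesis
      by (simp add: Upsilon_def divide_ennreal_def c_def \<rho>_def)
  qed
  have ctop: "ennreal c < \<infinity>" by simp
  note ids = resolvent_spectral_identities[where T=T and h=fhat and \<rho>=\<rho> and c="ennreal c", OF _ _ \<rho>0 _ ctop T, folded Rbar]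
  have R0: "Rbar \<beta> f 0 = Upsilon fhat \<Psi> \<beta>" if "\<beta> > 0" for \<beta>
    unfolding Ups[OF that] by (rule ids(1)) (use that in auto)
  have Rle: "Rbar \<beta> f x \<le> Upsilon fhat \<Psi> \<beta>" if "\<beta> > 0" for \<beta> x
    unfolding Ups[OF that] by (rule ids(3)) (use that in auto)
  have sup: "(SUP x. Rbar \<beta> f x) = Upsilon fhat \<Psi> \<beta>" if "\<beta> > 0" for \<beta>
  proof (rule antisym)
    show "(SUP x. Rbar \<beta> f x) \<le> Upsilon fhat \<Psi> \<beta>" using Rle[OF that] by (intro SUP_least)
    show "Upsilon fhat \<Psi> \<beta> \<le> (SUP x. Rbar \<beta> f x)"
      unfolding R0[OF that, symmetric] by (rule SUP_upper) simp
  qed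
  have finite: "Upsilon fhat \<Psi> \<beta> < \<infinity>" if U1: "Upsilon fhat \<Psi> 1 < \<infinity>" and \<beta>: "\<beta> > 0" for \<beta>
  proof -
    \<comment> \<open>The bound 1 + r \<le> max 1 (1 / \<beta>) * (\<beta> + r) for r \<ge> 0 compares the integrands at \<beta> and at 1.\<close>
    let ?m = "max 1 (1 / \<beta>)"
    have "Upsilon fhat \<Psi> \<beta> \<le> ennreal c * (\<integral>\<^sup>+\<xi>. ennreal ?m * (fhat \<xi> * ennreal (1 / (1 + 2 * \<rho> \<xi>))) \<partial>lborel)"
      unfolding Ups[OF \<beta>]
    proof (intro mult_left_mono[OF nn_integral_mono] zero_le)
      fix \<xi>
      have "1 + 2 * \<rho> \<xi> \<le> ?m * (\<beta> + 2 * \<rho> \<xi>)"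
      proof -
        have "1 \<le> ?m * \<beta>" using \<beta> mult_right_mono[of "1 / \<beta>" ?m \<beta>] by simp
        moreover have "2 * \<rho> \<xi> \<le> ?m * (2 * \<rho> \<xi>)" using mult_right_mono[of 1 ?m "2 * \<rho> \<xi>"] \<rho>0 by simp
        ultimately show ?thesis by (simp only: distrib_left)
      qed
      then have "1 / (\<beta> + 2 * \<rho> \<xi>) \<le> ?m * (1 / (1 + 2 * \<rho> \<xi>))"
        using \<rho>0[of \<xi>] \<beta> by (simp add: divide_simps add_pos_nonneg)
      then have "ennreal (1 / (\<beta> + 2 * \<rho> \<xi>)) \<le> ennreal ?m * ennreal (1 / (1 + 2 * \<rho> \<xi>))"
        by (subst ennreal_mult'[symmetric]) (auto intro: ennreal_leI)
      from mult_left_mono[OF this, of "fhat \<xi>"]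
      show "fhat \<xi> * ennreal (1 / (\<beta> + 2 * \<rho> \<xi>)) \<le> ennreal ?m * (fhat \<xi> * ennreal (1 / (1 + 2 * \<rho> \<xi>)))"
        by (simp only: mult.left_commute zero_le)
    qed
    also have "\<dots> = ennreal ?m * Upsilon fhat \<Psi> 1"
      unfolding Ups[OF zero_less_one] by (subst nn_integral_cmult) (auto simp: mult_ac)
    also have "\<dots> < \<infinity>" using U1 by (auto simp: ennreal_mult_less_top)
    finally show ?thesis .
  qed
  have C0: "\<exists>\<pi>\<in>C0. AE x in lborel. enn2ereal (Rbar \<beta> f x) = ereal (\<pi> x)"
    if U1: "Upsilon fhat \<Psi> 1 < \<infinity>" and \<beta>: "\<beta> > 0" for \<beta>
  proof -
    have "\<exists>\<pi>\<in>C0. \<forall>x. enn2ereal (Rbar \<beta> f x) = ereal (\<pi> x)"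
      unfolding Rbar
      by (rule resolvent_C0_version[OF _ _ tempered_AE_finite[OF tempfhat] \<rho>0 \<beta> c T])
        (use finite[OF U1 \<beta>] in \<open>simp_all add: Ups[OF \<beta>]\<close>)
    then show ?thesis by auto
  qed
  have iff: "(\<forall>\<alpha>>0. Rbar \<alpha> f 0 < \<infinity>) \<longleftrightarrow> Upsilon fhat \<Psi> 1 < \<infinity>"
    using R0 finite by (metis zero_less_one)
  show ?thesis
    using R0 sup iff C0 by auto
qed

end
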